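(* Let $\mathsf{f}\in\mathcal{D}'(\mathbb{R}^d)$ and let $U\subset\mathbb{R}^d$ be open. Then $\mathsf{f}$ is a regular distribution in $U$ given by a bounded function $f\in L^\infty(U)$ if and only if there exists a constant $M>0$ such that $$|\langle \mathsf{f}(\mathbf{x}),\phi(\mathbf{x})\rangle|\le M$$ for all positive, normalized test functions $\phi\in\mathcal{D}(U)$.
   Context: $\mathcal{D}(\mathbb{R}^d)$ is the space of compactly supported $C^\infty$ functions on $\mathbb{R}^d$ with its usual inductive limit topology, $\mathcal{D}'(\mathbb{R}^d)$ is its dual (distributions), and $\mathcal{D}(U)$ is the subspace of test functions with compact support contained in $U$. A test function $\phi$ is positive if $\phi\ge 0$ everywhere, and normalized if $\int\phi\,\mathrm{d}\mathbf{x}=1$. The distribution $\mathsf{f}$ is a regular distribution in $U$ given by the function $f$ if $f$ is locally integrable in $U$ and $\langle\mathsf{f},\phi\rangle=\int_U f(\mathbf{x})\phi(\mathbf{x})\,\mathrm{d}\mathbf{x}$ for all $\phi\in\mathcal{D}(U)$. *)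

theory Defs
  imports "HOL-Analysis.Analysis"
begin

type_synonym 'd cfun = "real ^ 'd \<Rightarrow> complex"

subsection \<open>Test functions\<close>

definition partial_deriv :: "'d::finite \<Rightarrow> 'd cfun \<Rightarrow> 'd cfun" where
  "partial_deriv i \<phi> = (\<lambda>x. frechet_derivative \<phi> (at x) (axis i 1))"

text \<open>A multi-index of order \<open>m\<close> is encoded as a list of \<open>m\<close> directions.\<close>

definition partial_derivs :: "'d::finite list \<Rightarrow> 'd cfun \<Rightarrow> 'd cfun" where
  "partial_derivs is \<phi> = foldr partial_deriv is \<phi>"

text \<open>The list may be empty, so \<open>\<phi>\<close> itself is differentiable; every iterated partial derivative is
  differentiable and hence continuous, so this is the class of \<open>C\<^sup>\<infinity>\<close> functions.\<close>

definition smooth :: "'d::finite cfun \<Rightarrow> bool" where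
  "smooth \<phi> \<longleftrightarrow> (\<forall>is. partial_derivs is \<phi> differentiable_on UNIV)"

definition supp :: "'d::finite cfun \<Rightarrow> (real ^ 'd) set" where
  "supp \<phi> = closure {x. \<phi> x \<noteq> 0}"

definition test_functions_on :: "(real ^ 'd::finite) set \<Rightarrow> 'd cfun set" where
  "test_functions_on U = {\<phi>. smooth \<phi> \<and> compact (supp \<phi>) \<and> supp \<phi> \<subseteq> U}"

abbreviation test_functions :: "'d::finite cfun set" where
  "test_functions \<equiv> test_functions_on UNIV"

definition positive_fun :: "'d::finite cfun \<Rightarrow> bool" where
  "positive_fun \<phi> \<longleftrightarrow> (\<forall>x. \<phi> x \<in> \<real> \<and> 0 \<le> Re (\<phi> x))"

definition normalized :: "'d::finite cfun \<Rightarrow> bool" where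
  "normalized \<phi> \<longleftrightarrow> (LINT x|lebesgue. \<phi> x) = 1"

subsection \<open>The inductive limit topology and its dual\<close>

text \<open>For compact \<open>K\<close>, the Frechet topology on \<open>\<D>\<^sub>K = test_functions_on K\<close> is the one of uniform
  convergence of all derivatives.\<close>

definition DK_topology :: "(real ^ 'd::finite) set \<Rightarrow> 'd cfun topology" where
  "DK_topology K = topology_generated_by
     {{\<psi> \<in> test_functions_on K. \<forall>is. length is \<le> m \<longrightarrow>
          (\<forall>x. cmod (partial_derivs is \<psi> x - partial_derivs is \<phi> x) < \<epsilon>)} | \<phi> m \<epsilon>.
        \<phi> \<in> test_functions_on K \<and> (0::real) < \<epsilon>}"

definition convex_funs :: "'d::finite cfun set \<Rightarrow> bool" where
  "convex_funs W \<longleftrightarrow> (\<forall>\<phi>\<in>W. \<forall>\<psi>\<in>W. \<forall>t\<in>{0..1::real}.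
      (\<lambda>x. of_real (1 - t) * \<phi> x + of_real t * \<psi> x) \<in> W)"

definition balanced_funs :: "'d::finite cfun set \<Rightarrow> bool" where
  "balanced_funs W \<longleftrightarrow> (\<forall>\<phi>\<in>W. \<forall>c. cmod c \<le> 1 \<longrightarrow> (\<lambda>x. c * \<phi> x) \<in> W)"

text \<open>The finest locally convex topology for which all inclusions of the spaces \<open>\<D>\<^sub>K\<close> are continuous:
  a base is given by the translates of the convex balanced sets whose trace on each \<open>\<D>\<^sub>K\<close> is open.\<close>

definition LF_base_zero :: "'d::finite cfun set set" where
  "LF_base_zero = {W. W \<subseteq> test_functions \<and> convex_funs W \<and> balanced_funs W \<and>
      (\<forall>K. compact K \<longrightarrow> openin (DK_topology K) (W \<inter> test_functions_on K))}"

definition test_topology :: "'d::finite cfun topology" where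
  "test_topology = topology_generated_by
     {(\<lambda>\<psi> x. \<phi> x + \<psi> x) ` W | \<phi> W. \<phi> \<in> test_functions \<and> W \<in> LF_base_zero}"

text \<open>A distribution is a function on all of \<open>'d cfun\<close>; only its values on test functions matter.\<close>

definition distribution :: "('d::finite cfun \<Rightarrow> complex) \<Rightarrow> bool" where
  "distribution F \<longleftrightarrow>
     (\<forall>\<phi>\<in>test_functions. \<forall>\<psi>\<in>test_functions. F (\<lambda>x. \<phi> x + \<psi> x) = F \<phi> + F \<psi>) \<and>
     (\<forall>c. \<forall>\<phi>\<in>test_functions. F (\<lambda>x. c * \<phi> x) = c * F \<phi>) \<and>
     continuous_map test_topology euclidean F"

subsection \<open>Regular distributions\<close>

definition locally_integrable_in :: "(real ^ 'd::finite) set \<Rightarrow> 'd cfun \<Rightarrow> bool" where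
  "locally_integrable_in U f \<longleftrightarrow> (\<forall>K. compact K \<and> K \<subseteq> U \<longrightarrow> set_integrable lebesgue K f)"

definition regular_in_given_by ::
    "('d::finite cfun \<Rightarrow> complex) \<Rightarrow> (real ^ 'd) set \<Rightarrow> 'd cfun \<Rightarrow> bool" where
  "regular_in_given_by F U f \<longleftrightarrow> locally_integrable_in U f \<and>
     (\<forall>\<phi>\<in>test_functions_on U. F \<phi> = (LINT x:U|lebesgue. f x * \<phi> x))"

text \<open>Representatives of elements of \<open>L\<^sup>\<infinity>(U)\<close>.\<close>

definition Linfty :: "(real ^ 'd::finite) set \<Rightarrow> 'd cfun set" where
  "Linfty U = {f. f \<in> borel_measurable (lebesgue_on U) \<and>
      (\<exists>C::real. AE x in lebesgue_on U. cmod (f x) \<le> C)}"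

end

theory Submission imports Defs begin

text \<open>For the non-trivial direction, scaling turns the hypothesis into
  \<open>\<bar>F \<phi>\<bar> \<le> M \<integral>\<phi>\<close> for all positive test functions. A real test function \<open>\<phi>\<close> is a difference of
  two positive ones whose integrals add up to nearly \<open>\<integral>\<bar>\<phi>\<bar>\<close>, so \<open>\<bar>F \<phi>\<bar> \<le> M \<integral>\<bar>\<phi>\<bar>\<close>. Real test functions
  are dense in \<open>L\<^sup>1(U)\<close>, hence the real and imaginary parts of \<open>F\<close> extend to bounded functionals
  on \<open>L\<^sup>1(U)\<close>, and these are given by functions bounded by \<open>M\<close>. The duality is
  obtained from the Radon-Nikodym theorem. All smooth approximations are polynomials in test functions
  (Stone-Weierstrass), so that no convolution is needed.\<close>

subsection \<open>Smooth functions\<close>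

text \<open>The obstacle is truncation: for a test function \<open>g\<close>, the functions
  \<open>max 0 (g x)\<close> and \<open>min 1 (g x)\<close> are only continuous. If a polynomial
  \<open>q\<close> is uniformly close to the truncation on the range of \<open>g\<close>, then
  \<open>q (g x) - q 0\<close> is smooth and vanishes wherever \<open>g\<close> does, so it is a
  test function in the same open set. Its error is uniformly small and zero wherever
  \<open>g\<close> vanishes. On a finite measure set such an error is small in the mean, and it can
  be dominated pointwise by a small multiple of a bump that is at least 1 on a compact set carrying
  \<open>g\<close>. Order arguments and Radon-Nikodym need real functionals, so the real and
  imaginary parts of \<open>F\<close> are represented separately. Each density is bounded by
  \<open>M\<close>, and adding them gives the bound \<open>2 * M\<close> for the complex density,
  which is enough for membership in \<open>Linfty U\<close>.\<close>

lemma partial_deriv_eqI: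
  assumes "\<And>x. (\<phi> has_derivative \<phi>' x) (at x)"
  shows "partial_deriv i \<phi> = (\<lambda>x. \<phi>' x (axis i 1))"
  by (rule ext) (simp add: partial_deriv_def flip: frechet_derivative_at[OF assms])

text \<open>\<open>smooth\<close> speaks of all iterated derivatives at once, and closed forms for
  them are unwieldy. An invariant class that is stable under \<open>partial_deriv\<close> replaces
  them; each use below only has to name such a class.\<close>

lemma smooth_coinduct:
  assumes "\<phi> \<in> X"
    and "\<And>\<psi> x. \<psi> \<in> X \<Longrightarrow> \<psi> differentiable (at x)"
    and "\<And>\<psi> i. \<psi> \<in> X \<Longrightarrow> partial_deriv i \<psi> \<in> X"
  shows "smooth \<phi>"
proof -
  have "partial_derivs is \<phi> \<in> X" for "is"
    using assms(1,3) by (induction "is") (auto simp: partial_derivs_def)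
  then show ?thesis
    unfolding smooth_def differentiable_on_def using assms(2) by simp
qed

lemma smooth_imp_differentiable: "smooth \<phi> \<Longrightarrow> \<phi> differentiable (at x)"
  using spec[of "\<lambda>is. partial_derivs is \<phi> differentiable_on UNIV" "[]"]
  unfolding smooth_def by (simp add: differentiable_on_def partial_derivs_def)

lemma smooth_has_derivative:
  "smooth \<phi> \<Longrightarrow> (\<phi> has_derivative frechet_derivative \<phi> (at x)) (at x)"
  using frechet_derivative_works smooth_imp_differentiable by blast

lemma smooth_partial_deriv: "smooth \<phi> \<Longrightarrow> smooth (partial_deriv i \<phi>)"
proof -
  \<comment> \<open>\<open>foldr\<close> applies the last direction of the list first, so
    differentiating beforehand appends \<open>i\<close> at the end.\<close>
  have "partial_derivs is (partial_deriv i \<phi>) = partial_derivs (is @ [i]) \<phi>" for "is"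
    by (simp add: partial_derivs_def)
  then show "smooth \<phi> \<Longrightarrow> smooth (partial_deriv i \<phi>)"
    unfolding smooth_def by simp
qed

lemma smooth_continuous_on: "smooth \<phi> \<Longrightarrow> continuous_on S \<phi>"
  by (intro continuous_at_imp_continuous_on ballI differentiable_imp_continuous_within
      smooth_imp_differentiable)

text \<open>Bounded linear maps commute with differentiation. Linearity is over the reals, so
  \<open>L\<close> may be the projection to the real or the imaginary part.\<close>

lemma smooth_bounded_linear:
  assumes "smooth \<phi>" and L: "bounded_linear L"
  shows "smooth (\<lambda>x. L (\<phi> x))"
proof (rule smooth_coinduct[where X="{\<lambda>x. L (\<psi> x) |\<psi>. smooth \<psi>}"])
  fix f :: "'a cfun" and i and x assume "f \<in> {\<lambda>x. L (\<psi> x) |\<psi>. smooth \<psi>}"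
  then obtain \<psi> where \<psi>: "f = (\<lambda>x. L (\<psi> x))" "smooth \<psi>" by blast
  have deriv: "(f has_derivative (\<lambda>h. L (frechet_derivative \<psi> (at y) h))) (at y)" for y
    unfolding \<psi>(1) by (rule bounded_linear.has_derivative[OF L smooth_has_derivative[OF \<psi>(2)]])
  show "f differentiable (at x)"
    using deriv by (rule differentiableI)
  have "partial_deriv i f = (\<lambda>x. L (partial_deriv i \<psi> x))"
    using partial_deriv_eqI[OF deriv] by (simp add: partial_deriv_def)
  then show "partial_deriv i f \<in> {\<lambda>x. L (\<psi> x) |\<psi>. smooth \<psi>}"
    using smooth_partial_deriv[OF \<psi>(2)] by blast
qed (use assms in auto)

lemma smooth_const: "smooth (\<lambda>_. c)"
proof (rule smooth_coinduct[where X="range (\<lambda>c _. c)"])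
  fix f :: "'a cfun" and i and x assume "f \<in> range (\<lambda>c _. c)"
  then obtain c where c: "f = (\<lambda>_. c)" by blast
  show "f differentiable (at x)" unfolding c by simp
  have "partial_deriv i f = (\<lambda>_. 0)"
    unfolding c by (rule partial_deriv_eqI) (rule has_derivative_const)
  then show "partial_deriv i f \<in> range (\<lambda>c _. c)" by blast
qed auto

section \<open>Closure of smooth functions under sums, products and polynomials\<close>

text \<open>By the Leibniz rule, the derivative of a product is a sum of products, so the products
  alone are not an invariant class. The algebra generated by the smooth functions is one, and it
  turns out to contain nothing but smooth functions.\<close>

inductive_set smooth_algebra :: "'d::finite cfun set" where
  smooth: "smooth \<phi> \<Longrightarrow> \<phi> \<in> smooth_algebra"
| add: "\<phi> \<in> smooth_algebra \<Longrightarrow> \<psi> \<in> smooth_algebra \<Longrightarrow> (\<lambda>x. \<phi> x + \<psi> x) \<in> smooth_algebra"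
| mult: "\<phi> \<in> smooth_algebra \<Longrightarrow> \<psi> \<in> smooth_algebra \<Longrightarrow> (\<lambda>x. \<phi> x * \<psi> x) \<in> smooth_algebra"

lemma smooth_algebra_differentiable: "\<phi> \<in> smooth_algebra \<Longrightarrow> \<phi> differentiable (at x)"
  by (induction rule: smooth_algebra.induct) (auto intro: smooth_imp_differentiable)

lemma smooth_algebra_partial_deriv: "\<phi> \<in> smooth_algebra \<Longrightarrow> partial_deriv i \<phi> \<in> smooth_algebra"
proof (induction rule: smooth_algebra.induct)
  case (smooth \<phi>)
  then show ?case by (intro smooth_algebra.smooth smooth_partial_deriv)
next
  case (add \<phi> \<psi>)
  have "(f has_derivative frechet_derivative f (at x)) (at x)" if "f \<in> {\<phi>, \<psi>}" for f x
    using that add.hyps by (auto simp flip: frechet_derivative_works intro: smooth_algebra_differentiable)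
  then have "partial_deriv i (\<lambda>x. \<phi> x + \<psi> x) = (\<lambda>x. partial_deriv i \<phi> x + partial_deriv i \<psi> x)"
    unfolding partial_deriv_def[of _ \<phi>] partial_deriv_def[of _ \<psi>]
    by (intro partial_deriv_eqI has_derivative_add) auto
  then show ?case using add.IH by (simp add: smooth_algebra.add)
next
  case (mult \<phi> \<psi>)
  have "(f has_derivative frechet_derivative f (at x)) (at x)" if "f \<in> {\<phi>, \<psi>}" for f x
    using that mult.hyps by (auto simp flip: frechet_derivative_works intro: smooth_algebra_differentiable)
  then have "partial_deriv i (\<lambda>x. \<phi> x * \<psi> x) =
      (\<lambda>x. \<phi> x * partial_deriv i \<psi> x + partial_deriv i \<phi> x * \<psi> x)"
    unfolding partial_deriv_def[of _ \<phi>] partial_deriv_def[of _ \<psi>]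
    by (intro partial_deriv_eqI has_derivative_mult) auto
  then show ?case
    using mult by (simp add: smooth_algebra.add smooth_algebra.mult)
qed

lemma smooth_algebra_smooth: "\<phi> \<in> smooth_algebra \<Longrightarrow> smooth \<phi>"
  by (rule smooth_coinduct[OF _ smooth_algebra_differentiable smooth_algebra_partial_deriv])

lemma smooth_add: "smooth \<phi> \<Longrightarrow> smooth \<psi> \<Longrightarrow> smooth (\<lambda>x. \<phi> x + \<psi> x)"
  and smooth_mult: "smooth \<phi> \<Longrightarrow> smooth \<psi> \<Longrightarrow> smooth (\<lambda>x. \<phi> x * \<psi> x)"
  by (auto intro!: smooth_algebra_smooth intro: smooth_algebra.intros)

lemma smooth_prod: "(\<And>i. i \<in> I \<Longrightarrow> smooth (\<phi> i)) \<Longrightarrow> smooth (\<lambda>x. \<Prod>i\<in>I. \<phi> i x)"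
  by (induction I rule: infinite_finite_induct) (auto intro: smooth_mult smooth_const)

lemma smooth_real_polynomial_function:
  fixes q :: "real \<Rightarrow> real"
  assumes "real_polynomial_function q" and g: "smooth (\<lambda>x. complex_of_real (g x))"
  shows "smooth (\<lambda>x. complex_of_real (q (g x)))"
  using assms(1)
proof (induction rule: real_polynomial_function.induct)
  case (linear f)
  have "f t = f 1 * t" for t
    using linear_scale[OF bounded_linear.linear[OF linear], of t 1] by simp
  then show ?case
    using smooth_mult[OF smooth_const g, of "of_real (f 1)"] by (metis (no_types) ext of_real_mult)
next
  case (mult p q)
  then show ?case using smooth_mult by fastforce
next
  case (add p q)
  then show ?case using smooth_add by fastforce
qed (rule smooth_const)

section \<open>A function that is flat at the origin\<close>

text \<open>The derivatives of \<open>exp (- 1 / t)\<close> at \<open>t > 0\<close> are polynomials in \<open>1 / t\<close> times the function itself.\<close>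

definition flat :: "real poly \<Rightarrow> real \<Rightarrow> real" where
  "flat p t = (if 0 < t then poly p (1 / t) * exp (- (1 / t)) else 0)"

text \<open>With \<open>y = 1 / t\<close> this is the decay of \<open>flat p t\<close> as
  \<open>t\<close> tends to 0 from the right.\<close>

lemma poly_times_exp_neg_tendsto_0: "((\<lambda>y::real. poly p y * exp (- y)) \<longlongrightarrow> 0) at_top"
proof -
  have "((\<lambda>y. \<Sum>k\<le>degree p. coeff p k * (y ^ k / exp y)) \<longlongrightarrow> (\<Sum>k\<le>degree p. coeff p k * 0)) at_top"
    by (intro tendsto_sum tendsto_mult_left tendsto_power_div_exp_0)
  moreover have "(\<Sum>k\<le>degree p. coeff p k * (y ^ k / exp y)) = poly p y * exp (- y)" for y :: real
    by (simp add: poly_altdef sum_distrib_right exp_minus divide_inverse mult.assoc)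
  ultimately show ?thesis by simp
qed

text \<open>Put \<open>s = 1 / t\<close> for \<open>t > 0\<close>. Then d/dt is \<open>- s^2\<close>
  times d/ds, and d/ds turns \<open>p(s) exp(-s)\<close> into \<open>(p'(s) - p(s)) exp(-s)\<close>.
  This yields the polynomial \<open>s^2 (p - p')\<close>, where \<open>[:0, 0, 1:]\<close> is
  \<open>s^2\<close>.\<close>

lemma flat_has_derivative:
  "(flat p has_real_derivative flat ([:0, 0, 1:] * (p - pderiv p)) t) (at t)"
proof -
  consider "t > 0" | "t < 0" | "t = 0" by linarith
  then show ?thesis
  proof cases
    case 1
    have "((\<lambda>t. poly p (1 / t) * exp (- (1 / t))) has_real_derivative
        flat ([:0, 0, 1:] * (p - pderiv p)) t) (at t)"
      using 1 by (auto intro!: derivative_eq_intros DERIV_chain'[of "\<lambda>t. 1 / t" _ t UNIV "poly p", OF _ poly_DERIV]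
          simp: flat_def field_simps power2_eq_square)
    then show ?thesis
      by (rule has_field_derivative_transform_within_open[of _ _ _ "{0<..}"])
        (use 1 in \<open>auto simp: flat_def\<close>)
  next
    case 2
    have "((\<lambda>t. 0) has_real_derivative flat ([:0, 0, 1:] * (p - pderiv p)) t) (at t)"
      using 2 by (simp add: flat_def)
    then show ?thesis
      by (rule has_field_derivative_transform_within_open[of _ _ _ "{..<0}"])
        (use 2 in \<open>auto simp: flat_def\<close>)
  next
    case 3
    \<comment> \<open>The difference quotient at 0 divides by \<open>h\<close>, which multiplies the
      polynomial in \<open>1 / h\<close> by its variable; hence \<open>pCons 0 p\<close>.\<close>
    have "((\<lambda>h. poly (pCons 0 p) (inverse h) * exp (- inverse h)) \<longlongrightarrow> 0) (at_right 0)"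
      by (rule filterlim_compose[OF poly_times_exp_neg_tendsto_0 filterlim_inverse_at_top_right])
    then have "((\<lambda>h. flat p h / h) \<longlongrightarrow> 0) (at_right 0)"
      by (rule Lim_transform_eventually)
        (auto simp: flat_def eventually_at_right_field divide_inverse intro!: exI[of _ 1])
    moreover have "((\<lambda>h. flat p h / h) \<longlongrightarrow> 0) (at_left 0)"
      by (rule Lim_transform_eventually[OF tendsto_const])
        (auto simp: flat_def eventually_at_left_field intro!: exI[of _ "-1"])
    ultimately have "((\<lambda>h. flat p h / h) \<longlongrightarrow> 0) (at 0)"
      by (simp add: filterlim_at_split)
    then show ?thesis
      using 3 by (simp add: has_field_derivative_iff flat_def)
  qed
qed

lemma flat_pos: "0 < t \<Longrightarrow> 0 < flat 1 t" and flat_nonpos: "t \<le> 0 \<Longrightarrow> flat p t = 0"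
  by (simp_all add: flat_def)

text \<open>Slopes \<open>s = 1\<close> and \<open>s = -1\<close> serve the lower and the upper face
  of a box. Letting \<open>p\<close> range over all polynomials makes the class stable under
  differentiation.\<close>

lemma smooth_flat_coord:
  fixes j :: "'d::finite"
  shows "smooth (\<lambda>x::real^'d. complex_of_real (flat p (s * x $ j + c)))"
proof (rule smooth_coinduct[where X="range (\<lambda>p x. complex_of_real (flat p (s * x $ j + c)))"])
  fix f :: "'d cfun" and i x
  assume "f \<in> range (\<lambda>p x. complex_of_real (flat p (s * x $ j + c)))"
  then obtain p where p: "f = (\<lambda>x. complex_of_real (flat p (s * x $ j + c)))" by blast
  define p' where "p' = [:0, 0, 1:] * (p - pderiv p)"
  have "((\<lambda>x. flat p (s * x $ j + c)) has_derivative (\<lambda>h. flat p' (s * y $ j + c) * (s * h $ j))) (at y)" for y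
  proof -
    have "((\<lambda>x::real^'d. s * x $ j + c) has_derivative (\<lambda>h. s * h $ j)) (at y)"
      by (auto intro!: derivative_eq_intros bounded_linear_imp_has_derivative bounded_linear_vec_nth)
    then show ?thesis
      unfolding p'_def
      by (rule has_derivative_compose[OF _ flat_has_derivative[unfolded has_field_derivative_def]])
  qed
  then have deriv: "(f has_derivative (\<lambda>h. complex_of_real (flat p' (s * y $ j + c) * (s * h $ j)))) (at y)" for y
    unfolding p by (intro has_derivative_of_real)
  show "f differentiable (at x)" using deriv by (rule differentiableI)
  \<comment> \<open>The inner derivative is a constant, namely \<open>s\<close> in direction
    \<open>j\<close> and 0 in the others, so the polynomial can absorb it.\<close>
  have "partial_deriv i f = (\<lambda>x. complex_of_real (flat (smult (if i = j then s else 0) p') (s * x $ j + c)))"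
    using partial_deriv_eqI[OF deriv, of i] by (auto simp: fun_eq_iff axis_def flat_def)
  then show "partial_deriv i f \<in> range (\<lambda>p x. complex_of_real (flat p (s * x $ j + c)))"
    by blast
qed auto

subsection \<open>Real test functions\<close>

text \<open>Order, truncation and duality are treated for real functions, while a distribution acts
  on complex ones; this is the interface between the two.\<close>

definition real_tests :: "(real ^ 'd::finite) set \<Rightarrow> (real ^ 'd \<Rightarrow> real) set" where
  "real_tests U = {g. (\<lambda>x. complex_of_real (g x)) \<in> test_functions_on U}"

text \<open>Any compact set off which the function vanishes can stand in for the support. Closure
  properties then need no computation of closures: a sum takes the union of two such sets.\<close>

lemma test_functions_onI:
  assumes "smooth \<phi>" "compact K" "K \<subseteq> U" "\<And>x. x \<notin> K \<Longrightarrow> \<phi> x = 0"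
  shows "\<phi> \<in> test_functions_on U"
proof -
  have "supp \<phi> \<subseteq> K"
    unfolding supp_def using assms(2,4) by (intro closure_minimal compact_imp_closed) auto
  moreover from this have "compact (supp \<phi>)"
    using assms(2) compact_Int_closed[of K "supp \<phi>"] by (simp add: supp_def Int_absorb1)
  ultimately show ?thesis using assms(1,3) unfolding test_functions_on_def by auto
qed

lemma test_functions_onE:
  assumes "\<phi> \<in> test_functions_on U"
  obtains K where "smooth \<phi>" "compact K" "K \<subseteq> U" "\<And>x. x \<notin> K \<Longrightarrow> \<phi> x = 0"
proof
  show "smooth \<phi>" "compact (supp \<phi>)" "supp \<phi> \<subseteq> U"
    using assms unfolding test_functions_on_def by auto
  show "\<phi> x = 0" if "x \<notin> supp \<phi>" for x
    using that closure_subset[of "{x. \<phi> x \<noteq> 0}"] unfolding supp_def by blast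
qed

lemma real_testsI:
  assumes "smooth (\<lambda>x. complex_of_real (g x))" "compact K" "K \<subseteq> U" "\<And>x. x \<notin> K \<Longrightarrow> g x = 0"
  shows "g \<in> real_tests U"
  using test_functions_onI[OF assms(1-3)] assms(4) unfolding real_tests_def by simp

lemma real_testsE:
  assumes "g \<in> real_tests U"
  obtains K where "smooth (\<lambda>x. complex_of_real (g x))" "compact K" "K \<subseteq> U" "\<And>x. x \<notin> K \<Longrightarrow> g x = 0"
proof -
  from assms have "(\<lambda>x. complex_of_real (g x)) \<in> test_functions_on U" by (simp add: real_tests_def)
  then show thesis by (rule test_functions_onE) (simp add: that)
qed

lemma real_tests_mono: "U \<subseteq> V \<Longrightarrow> real_tests U \<subseteq> real_tests V"
  unfolding real_tests_def test_functions_on_def by auto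

lemma real_tests_add: "g \<in> real_tests U \<Longrightarrow> h \<in> real_tests U \<Longrightarrow> (\<lambda>x. g x + h x) \<in> real_tests U"
proof (elim real_testsE)
  fix K L
  assume *: "compact K" "K \<subseteq> U" "\<And>x. x \<notin> K \<Longrightarrow> g x = 0" "smooth (\<lambda>x. complex_of_real (g x))"
    "compact L" "L \<subseteq> U" "\<And>x. x \<notin> L \<Longrightarrow> h x = 0" "smooth (\<lambda>x. complex_of_real (h x))"
  show "(\<lambda>x. g x + h x) \<in> real_tests U"
    by (rule real_testsI[of _ "K \<union> L"]) (use * smooth_add in auto)
qed

lemma real_tests_scale: "g \<in> real_tests U \<Longrightarrow> (\<lambda>x. c * g x) \<in> real_tests U"
proof (elim real_testsE)
  fix K
  assume *: "compact K" "K \<subseteq> U" "\<And>x. x \<notin> K \<Longrightarrow> g x = 0" "smooth (\<lambda>x. complex_of_real (g x))"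
  show "(\<lambda>x. c * g x) \<in> real_tests U"
    by (rule real_testsI[of _ "K"]) (use * smooth_mult[OF smooth_const[of "of_real c"] *(4)] in auto)
qed

lemma real_tests_sum:
  assumes "\<And>i. i \<in> I \<Longrightarrow> g i \<in> real_tests U"
  shows "(\<lambda>x. \<Sum>i\<in>I. g i x) \<in> real_tests U"
proof -
  have "(\<lambda>_. 0) \<in> real_tests U"
    by (rule real_testsI[of _ "{}"]) (use smooth_const[of 0] in auto)
  then show ?thesis
    using assms by (induction I rule: infinite_finite_induct) (auto intro: real_tests_add)
qed

lemma real_tests_continuous_on: "g \<in> real_tests U \<Longrightarrow> continuous_on S g"
proof (elim real_testsE)
  assume "smooth (\<lambda>x. complex_of_real (g x))"
  from continuous_on_Re[OF smooth_continuous_on[OF this, of S]] show ?thesis by simp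
qed

section \<open>Bump functions and approximate truncation\<close>

text \<open>A product of functions of single coordinates handles boxes without any smoothness of the
  norm. In each coordinate one factor vanishes beyond the lower face and one beyond the upper
  face.\<close>

lemma box_bump:
  fixes a b :: "real ^ 'd::finite"
  obtains g where "g \<in> real_tests (cbox a b)" "\<And>x. 0 \<le> g x" "\<And>x. x \<in> box a b \<Longrightarrow> 0 < g x"
proof
  define g where "g x = (\<Prod>i\<in>UNIV. flat 1 (x $ i - a $ i) * flat 1 (b $ i - x $ i))" for x :: "real ^ 'd"
  have nonneg: "0 \<le> flat 1 t" for t by (simp add: flat_def)
  show "0 \<le> g x" for x unfolding g_def using nonneg by (intro prod_nonneg) simp
  show "0 < g x" if "x \<in> box a b" for x
    unfolding g_def using that by (intro prod_pos) (simp add: mem_box_cart flat_pos)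
  show "g \<in> real_tests (cbox a b)"
  proof (rule real_testsI)
    have "smooth (\<lambda>x::real^'d. \<Prod>i\<in>UNIV. complex_of_real (flat 1 (1 * x $ i + - a $ i)) *
        complex_of_real (flat 1 (- 1 * x $ i + b $ i)))"
      by (intro smooth_prod smooth_mult smooth_flat_coord)
    then show "smooth (\<lambda>x. complex_of_real (g x))" by (simp add: g_def)
    show "g x = 0" if x: "x \<notin> cbox a b" for x
    proof -
      obtain i where "x $ i < a $ i \<or> b $ i < x $ i"
        using x by (auto simp: mem_box_cart not_le)
      then have "flat 1 (x $ i - a $ i) * flat 1 (b $ i - x $ i) = 0"
        by (auto simp: flat_nonpos)
      then show ?thesis unfolding g_def by (intro prod_zero) auto
    qed
  qed auto
qed

lemma real_tests_ge_1_on_compact: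
  fixes K :: "(real ^ 'd::finite) set"
  assumes K: "compact K" and U: "open U" "K \<subseteq> U"
  obtains g where "g \<in> real_tests U" "\<And>x. 0 \<le> g x" "\<And>x. x \<in> K \<Longrightarrow> 1 \<le> g x"
proof -
  have "\<exists>g\<in>real_tests U. (\<forall>y. 0 \<le> g y) \<and> 0 < g x" if x: "x \<in> K" for x
  proof -
    obtain a b where ab: "cbox a b \<subseteq> U" "x \<in> box a b"
      by (rule open_contains_cbox[OF U(1) subsetD[OF U(2) x]]) (rule that)
    obtain g where g: "g \<in> real_tests (cbox a b)" "\<And>x. 0 \<le> g x" "\<And>x. x \<in> box a b \<Longrightarrow> 0 < g x"
      by (rule box_bump) (rule that)
    then show ?thesis using real_tests_mono[OF ab(1)] ab(2) by blast
  qed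
  then obtain B where B: "\<And>x. x \<in> K \<Longrightarrow> B x \<in> real_tests U"
    "\<And>x y. x \<in> K \<Longrightarrow> 0 \<le> B x y" "\<And>x. x \<in> K \<Longrightarrow> 0 < B x x"
    by metis
  have "open {y. 0 < B x y}" if "x \<in> K" for x
    using open_Collect_less[OF continuous_on_const real_tests_continuous_on[OF B(1)[OF that]]] by simp
  moreover have "K \<subseteq> (\<Union>x\<in>K. {y. 0 < B x y})" using B(3) by blast
  ultimately obtain C where C: "C \<subseteq> K" "finite C" "K \<subseteq> (\<Union>x\<in>C. {y. 0 < B x y})"
    by (rule compactE_image[OF K]) (assumption, rule that)
  define h where "h y = (\<Sum>x\<in>C. B x y)" for y
  have h: "h \<in> real_tests U" unfolding h_def using B(1) C(1) by (intro real_tests_sum) auto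
  have h_nonneg: "0 \<le> h y" for y unfolding h_def using B(2) C(1) by (intro sum_nonneg) auto
  have h_pos: "0 < h y" if y: "y \<in> K" for y
  proof -
    obtain x where "x \<in> C" "0 < B x y" using C(3) y by auto
    then show ?thesis
      unfolding h_def using C B(2) by (intro sum_pos2) auto
  qed
  obtain m where m: "0 < m" "\<And>y. y \<in> K \<Longrightarrow> m \<le> h y"
  proof (cases "K = {}")
    case False
    obtain z where "z \<in> K" "\<forall>y\<in>K. h z \<le> h y"
      using continuous_attains_inf[OF K False real_tests_continuous_on[OF h]] by blast
    then show ?thesis using h_pos by (intro that[of "h z"]) auto
  qed (use that[of 1] in auto)
  show thesis
  proof
    show "(\<lambda>y. (1 / m) * h y) \<in> real_tests U" using h by (rule real_tests_scale)
    show "0 \<le> (1 / m) * h y" for y using h_nonneg m(1) by simp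
    show "1 \<le> (1 / m) * h y" if "y \<in> K" for y using m(2)[OF that] m(1) by simp
  qed
qed

text \<open>The constant term of the approximating polynomial is subtracted, so the result vanishes
  where \<open>g\<close> does and has compact support in \<open>U\<close>. The instances used are
  truncation at 1 and the positive part.\<close>

lemma real_tests_approx_compose:
  fixes u :: "real \<Rightarrow> real"
  assumes g: "g \<in> real_tests U" and u: "continuous_on UNIV u" "u 0 = 0" and e: "0 < e"
  obtains h where "h \<in> real_tests U" "\<And>x. \<bar>h x - u (g x)\<bar> < e" "\<And>x. g x = 0 \<Longrightarrow> h x = 0"
proof -
  obtain K where K: "smooth (\<lambda>x. complex_of_real (g x))" "compact K" "K \<subseteq> U" "\<And>x. x \<notin> K \<Longrightarrow> g x = 0"
    using g by (rule real_testsE) (rule that)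
  \<comment> \<open>0 is the value of \<open>g\<close> off \<open>K\<close>, and approximation at 0
    controls the subtracted \<open>q 0\<close>. The two errors add up, hence \<open>e / 2\<close>
    each.\<close>
  have "compact (insert 0 (g ` K))"
    using K(2) g by (intro compact_insert compact_continuous_image real_tests_continuous_on)
  moreover have "continuous_on (insert 0 (g ` K)) u" using u(1) by (rule continuous_on_subset) simp
  ultimately obtain q where q: "real_polynomial_function q"
    "\<And>t. t \<in> insert 0 (g ` K) \<Longrightarrow> \<bar>u t - q t\<bar> < e / 2"
    using Stone_Weierstrass_real_polynomial_function[of _ u "e / 2"] e by (metis half_gt_zero)
  define h where "h x = q (g x) - q 0" for x
  show thesis
  proof
    show "g x = 0 \<Longrightarrow> h x = 0" for x by (simp add: h_def)
    have "real_polynomial_function (\<lambda>t. q t - q 0)"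
      using q(1) by (intro real_polynomial_function_diff real_polynomial_function.intros(2))
    from smooth_real_polynomial_function[OF this K(1)]
    show "h \<in> real_tests U"
      unfolding h_def using K by (intro real_testsI[of _ K]) auto
    fix x
    have "g x \<in> insert 0 (g ` K)" using K(4)[of x] by auto
    from q(2)[OF this] q(2)[OF insertI1] show "\<bar>h x - u (g x)\<bar> < e"
      unfolding h_def u(2) by linarith
  qed
qed

subsection \<open>Duality of integrable and bounded functions\<close>

text \<open>\<open>T\<close> acts on functions rather than on classes modulo null sets. By
  additivity, homogeneity and the bound, it takes equal values on integrable functions that agree
  almost everywhere, so it is a functional on L1.\<close>

definition bounded_L1_functional :: "'a measure \<Rightarrow> real \<Rightarrow> (('a \<Rightarrow> real) \<Rightarrow> real) \<Rightarrow> bool" where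
  "bounded_L1_functional M C T \<longleftrightarrow>
     (\<forall>g h. integrable M g \<longrightarrow> integrable M h \<longrightarrow> T (\<lambda>x. g x + h x) = T g + T h) \<and>
     (\<forall>c g. integrable M g \<longrightarrow> T (\<lambda>x. c * g x) = c * T g) \<and>
     (\<forall>g. integrable M g \<longrightarrow> \<bar>T g\<bar> \<le> C * (LINT x|M. \<bar>g x\<bar>))"

lemma bounded_L1_functionalD:
  assumes "bounded_L1_functional M C T" "integrable M g"
  shows "integrable M h \<Longrightarrow> T (\<lambda>x. g x + h x) = T g + T h"
    and "T (\<lambda>x. c * g x) = c * T g"
    and "\<bar>T g\<bar> \<le> C * (LINT x|M. \<bar>g x\<bar>)"
  using assms unfolding bounded_L1_functional_def by blast+

lemma bounded_L1_functional_diff: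
  assumes "bounded_L1_functional M C T" "integrable M g" "integrable M h"
  shows "T (\<lambda>x. g x - h x) = T g - T h"
  using bounded_L1_functionalD(1)[OF assms(1,2), of "\<lambda>x. -1 * h x"]
    bounded_L1_functionalD(2)[OF assms(1,3), of "-1"] assms(3)
  by simp

text \<open>Dominated convergence gives convergence in the mean, and \<open>T\<close> is Lipschitz
  for the distance in the mean. This serves the limit case of the induction over integrable
  functions.\<close>

lemma bounded_L1_functional_tendsto:
  assumes T: "bounded_L1_functional M C T"
    and s: "\<And>i. integrable M (s i)" and f: "integrable M f"
    and lim: "\<And>x. x \<in> space M \<Longrightarrow> (\<lambda>i. s i x) \<longlonglongrightarrow> f x"
    and bound: "\<And>i x. x \<in> space M \<Longrightarrow> \<bar>s i x\<bar> \<le> w x" and w: "integrable M w"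
  shows "(\<lambda>i. T (s i)) \<longlonglongrightarrow> T f"
proof -
  have "(\<lambda>i. LINT x|M. \<bar>s i x - f x\<bar>) \<longlonglongrightarrow> (LINT x|M. (0::real))"
  proof (rule integral_dominated_convergence[where w="\<lambda>x. w x + \<bar>f x\<bar>"])
    show "AE x in M. (\<lambda>i. \<bar>s i x - f x\<bar>) \<longlonglongrightarrow> 0"
      using lim by (auto intro!: AE_I2 tendsto_rabs_zero simp: LIM_zero_iff)
    show "AE x in M. norm \<bar>s i x - f x\<bar> \<le> w x + \<bar>f x\<bar>" for i
      using bound[of _ i] by (intro AE_I2) (fastforce simp: abs_if split: if_splits)
  qed (use s f w in auto)
  then have lim0: "(\<lambda>i. C * (LINT x|M. \<bar>s i x - f x\<bar>)) \<longlonglongrightarrow> 0"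
    by (auto intro: tendsto_mult_right_zero)
  have dist: "\<bar>T (s i) - T f\<bar> \<le> C * (LINT x|M. \<bar>s i x - f x\<bar>)" for i
    using bounded_L1_functionalD(3)[OF T Bochner_Integration.integrable_diff[OF s[of i] f]]
      bounded_L1_functional_diff[OF T s[of i] f] by simp
  have "(\<lambda>i. T (s i) - T f) \<longlonglongrightarrow> 0"
    by (rule Lim_null_comparison[OF _ lim0]) (simp add: dist)
  then show ?thesis by (simp add: LIM_zero_iff)
qed

lemma L1_dist_triangle:
  fixes f g h :: "'a \<Rightarrow> real"
  assumes "integrable M f" "integrable M g" "integrable M h"
  shows "(LINT x|M. \<bar>f x - h x\<bar>) \<le> (LINT x|M. \<bar>f x - g x\<bar>) + (LINT x|M. \<bar>g x - h x\<bar>)"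
proof -
  have "(LINT x|M. \<bar>f x - h x\<bar>) \<le> (LINT x|M. \<bar>f x - g x\<bar> + \<bar>g x - h x\<bar>)"
    using assms by (intro integral_mono) auto
  also have "\<dots> = (LINT x|M. \<bar>f x - g x\<bar>) + (LINT x|M. \<bar>g x - h x\<bar>)"
    using assms by (intro Bochner_Integration.integral_add) auto
  finally show ?thesis .
qed

text \<open>The extension at \<open>g\<close> is the only number within \<open>C * \<integral>\<bar>g - \<phi>\<bar>\<close> of \<open>T \<phi>\<close> for every \<open>\<phi> \<in> V\<close>.\<close>

lemma L1_dense_extension:
  fixes T :: "('a \<Rightarrow> real) \<Rightarrow> real"
  assumes C: "0 < C"
    and int: "\<And>\<phi>. \<phi> \<in> V \<Longrightarrow> integrable M \<phi>"
    and V_add: "\<And>\<phi> \<psi>. \<phi> \<in> V \<Longrightarrow> \<psi> \<in> V \<Longrightarrow> (\<lambda>x. \<phi> x + \<psi> x) \<in> V"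
    and V_scale: "\<And>c \<phi>. \<phi> \<in> V \<Longrightarrow> (\<lambda>x. c * \<phi> x) \<in> V"
    and T_add: "\<And>\<phi> \<psi>. \<phi> \<in> V \<Longrightarrow> \<psi> \<in> V \<Longrightarrow> T (\<lambda>x. \<phi> x + \<psi> x) = T \<phi> + T \<psi>"
    and T_scale: "\<And>c \<phi>. \<phi> \<in> V \<Longrightarrow> T (\<lambda>x. c * \<phi> x) = c * T \<phi>"
    and T_bound: "\<And>\<phi>. \<phi> \<in> V \<Longrightarrow> \<bar>T \<phi>\<bar> \<le> C * (LINT x|M. \<bar>\<phi> x\<bar>)"
    and dense: "\<And>g e. integrable M g \<Longrightarrow> 0 < e \<Longrightarrow> \<exists>\<phi>\<in>V. (LINT x|M. \<bar>g x - \<phi> x\<bar>) < e"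
  obtains T' where "bounded_L1_functional M C T'" "\<And>\<phi>. \<phi> \<in> V \<Longrightarrow> T' \<phi> = T \<phi>"
proof -
  define d where "d g h = (LINT x|M. \<bar>g x - h x\<bar>)" for g h :: "'a \<Rightarrow> real"
  have d_commute: "d g h = d h g" for g h
    unfolding d_def by (simp add: abs_minus_commute)
  have T_dist: "\<bar>T \<phi> - T \<psi>\<bar> \<le> C * d \<phi> \<psi>" if "\<phi> \<in> V" "\<psi> \<in> V" for \<phi> \<psi>
    using T_add[OF that(1) V_scale[OF that(2), of "-1"]] T_scale[OF that(2), of "-1"]
      T_bound[OF V_add[OF that(1) V_scale[OF that(2), of "-1"]]]
    by (simp add: d_def)
  obtain \<phi>\<^sub>0 where "\<phi>\<^sub>0 \<in> V"
    using dense[of "\<lambda>_. 0" 1] by auto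
  \<comment> \<open>Each \<open>\<phi> \<in> V\<close> gives an interval of radius
    \<open>C * d g \<phi>\<close> around \<open>T \<phi>\<close>. By \<open>cross\<close>, no left
    endpoint exceeds a right endpoint, so the supremum of the left endpoints lies in all of these
    intervals.\<close>
  define T' where "T' g = (SUP \<phi>\<in>V. T \<phi> - C * d g \<phi>)" for g
  have cross: "T \<phi> - C * d g \<phi> \<le> T \<psi> + C * d g \<psi>"
    if "integrable M g" "\<phi> \<in> V" "\<psi> \<in> V" for g \<phi> \<psi>
  proof -
    have "C * d \<phi> \<psi> \<le> C * (d \<phi> g + d g \<psi>)"
      using C L1_dist_triangle[OF int that(1) int, OF that(2,3)] unfolding d_def by simp
    then show ?thesis
      using T_dist[OF that(2,3)] d_commute[of g \<phi>] by (simp add: algebra_simps)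
  qed
  have near: "\<bar>T' g - T \<phi>\<bar> \<le> C * d g \<phi>" if g: "integrable M g" and \<phi>: "\<phi> \<in> V" for g \<phi>
  proof -
    have "bdd_above ((\<lambda>\<phi>. T \<phi> - C * d g \<phi>) ` V)"
      using cross[OF g _ \<phi>] by (intro bdd_aboveI2[where M="T \<phi> + C * d g \<phi>"])
    then have "T \<phi> - C * d g \<phi> \<le> T' g"
      unfolding T'_def by (rule cSUP_upper[OF \<phi>])
    moreover have "T' g \<le> T \<phi> + C * d g \<phi>"
      unfolding T'_def using \<open>\<phi>\<^sub>0 \<in> V\<close> cross[OF g _ \<phi>] by (intro cSUP_least) auto
    ultimately show ?thesis by linarith
  qed
  have approx: "\<exists>\<phi>\<in>V. C * d g \<phi> < e" if "integrable M g" "0 < e" for g e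
    using dense[OF that(1), of "e / C"] that(2) C by (auto simp: d_def field_simps)
  have T'_eq: "T' \<phi> = T \<phi>" if "\<phi> \<in> V" for \<phi>
    using near[OF int that, OF that] by (simp add: d_def)
  have "bounded_L1_functional M C T'"
    unfolding bounded_L1_functional_def
  proof (intro conjI allI impI)
    fix g h :: "'a \<Rightarrow> real" assume g: "integrable M g" and h: "integrable M h"
    have "\<bar>T' (\<lambda>x. g x + h x) - (T' g + T' h)\<bar> \<le> e" if "0 < e" for e
    proof -
      \<comment> \<open>Each of the two approximation errors enters twice: once through the sum and
        once through the separate values of \<open>T'\<close>.\<close>
      obtain \<phi> \<psi> where \<phi>: "\<phi> \<in> V" "C * d g \<phi> < e / 4" and \<psi>: "\<psi> \<in> V" "C * d h \<psi> < e / 4"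
        using approx[OF g, of "e/4"] approx[OF h, of "e/4"] \<open>0 < e\<close> by auto
      have "d (\<lambda>x. g x + h x) (\<lambda>x. \<phi> x + \<psi> x) \<le> d g \<phi> + d h \<psi>"
      proof -
        have "d (\<lambda>x. g x + h x) (\<lambda>x. \<phi> x + \<psi> x) \<le> (LINT x|M. \<bar>g x - \<phi> x\<bar> + \<bar>h x - \<psi> x\<bar>)"
          unfolding d_def using g h int[OF \<phi>(1)] int[OF \<psi>(1)] by (intro integral_mono) auto
        also have "\<dots> = d g \<phi> + d h \<psi>"
          unfolding d_def using g h int[OF \<phi>(1)] int[OF \<psi>(1)]
          by (intro Bochner_Integration.integral_add) auto
        finally show ?thesis .
      qed
      then have "C * d (\<lambda>x. g x + h x) (\<lambda>x. \<phi> x + \<psi> x) \<le> C * d g \<phi> + C * d h \<psi>"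
        using C by (simp flip: distrib_left)
      moreover have "\<bar>T' (\<lambda>x. g x + h x) - (T \<phi> + T \<psi>)\<bar> \<le> C * d (\<lambda>x. g x + h x) (\<lambda>x. \<phi> x + \<psi> x)"
        using near[of "\<lambda>x. g x + h x", OF _ V_add[OF \<phi>(1) \<psi>(1)]] g h T_add[OF \<phi>(1) \<psi>(1)] by simp
      ultimately show ?thesis
        using near[OF g \<phi>(1)] near[OF h \<psi>(1)] \<phi>(2) \<psi>(2) by linarith
    qed
    then have "\<bar>T' (\<lambda>x. g x + h x) - (T' g + T' h)\<bar> \<le> 0"
      by (rule field_le_epsilon) simp
    then show "T' (\<lambda>x. g x + h x) = T' g + T' h" by simp
  next
    fix c and g :: "'a \<Rightarrow> real" assume g: "integrable M g"
    have "\<bar>T' (\<lambda>x. c * g x) - c * T' g\<bar> \<le> e" if "0 < e" for e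
    proof -
      \<comment> \<open>The summand 1 keeps the denominator positive when
        \<open>c = 0\<close>.\<close>
      have "0 < e / (2 * (\<bar>c\<bar> + 1))" using \<open>0 < e\<close> by (simp add: add_nonneg_pos)
      then obtain \<phi> where \<phi>: "\<phi> \<in> V" "C * d g \<phi> < e / (2 * (\<bar>c\<bar> + 1))"
        using approx[OF g] by blast
      have "\<bar>c\<bar> * (C * d g \<phi>) \<le> \<bar>c\<bar> * (e / (2 * (\<bar>c\<bar> + 1)))"
        using \<phi>(2) by (intro mult_left_mono) auto
      also have "\<dots> \<le> e / 2"
        using \<open>0 < e\<close> by (simp add: field_simps add_pos_nonneg)
      finally have small: "\<bar>c\<bar> * (C * d g \<phi>) \<le> e / 2" .
      have "d (\<lambda>x. c * g x) (\<lambda>x. c * \<phi> x) = \<bar>c\<bar> * d g \<phi>"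
        unfolding d_def by (simp add: abs_mult flip: right_diff_distrib)
      then have "\<bar>T' (\<lambda>x. c * g x) - c * T \<phi>\<bar> \<le> \<bar>c\<bar> * (C * d g \<phi>)"
        using near[of "\<lambda>x. c * g x", OF _ V_scale[OF \<phi>(1), of c]] g T_scale[OF \<phi>(1), of c]
        by (simp add: mult.left_commute)
      moreover have "\<bar>c * T' g - c * T \<phi>\<bar> \<le> \<bar>c\<bar> * (C * d g \<phi>)"
        using near[OF g \<phi>(1)] by (simp add: abs_mult mult_left_mono flip: right_diff_distrib)
      ultimately show ?thesis using small by linarith
    qed
    then have "\<bar>T' (\<lambda>x. c * g x) - c * T' g\<bar> \<le> 0"
      by (rule field_le_epsilon) simp
    then show "T' (\<lambda>x. c * g x) = c * T' g" by simp
  next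
    fix g :: "'a \<Rightarrow> real" assume g: "integrable M g"
    have zero: "(\<lambda>x. 0) \<in> V" "T (\<lambda>x. 0) = 0"
      using V_scale[OF \<open>\<phi>\<^sub>0 \<in> V\<close>, of 0] T_scale[OF \<open>\<phi>\<^sub>0 \<in> V\<close>, of 0] by simp_all
    show "\<bar>T' g\<bar> \<le> C * (LINT x|M. \<bar>g x\<bar>)"
      using near[OF g zero(1)] zero(2) by (simp add: d_def)
  qed
  then show thesis using T'_eq by (rule that)
qed

section \<open>The dual of L1, first for finite and then for sigma-finite measures\<close>

text \<open>Since the measure is finite, all indicators are integrable and \<open>T\<close>
  restricts to a signed set function dominated by \<open>C\<close> times the measure. Its density
  represents \<open>T\<close> on indicators, hence on all integrable functions by linearity and
  continuity.\<close>

lemma (in finite_measure) L1_dual_finite_measure: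
  assumes T: "bounded_L1_functional M C T" and C: "0 \<le> C"
  obtains f where "f \<in> borel_measurable M" "\<And>x. \<bar>f x\<bar> \<le> C"
    "\<And>g. integrable M g \<Longrightarrow> T g = (LINT x|M. f x * g x)"
proof -
  note TD = bounded_L1_functionalD[OF T]
  \<comment> \<open>Adding \<open>C\<close> times the measure makes the set function positive.\<close>
  define t where "t A = T (indicator A) + C * measure M A" for A
  have ind: "integrable M (indicator A :: 'a \<Rightarrow> real)" if "A \<in> sets M" for A
    using that by (simp add: integrable_indicator_iff flip: less_top)
  have T_ind: "\<bar>T (indicator A)\<bar> \<le> C * measure M A" if "A \<in> sets M" for A
    using TD(3)[OF ind[OF that]] sets.sets_into_space[OF that] by (simp add: Int_absorb2)
  have t_bounds: "0 \<le> t A" "t A \<le> 2 * C * measure M A" if "A \<in> sets M" for A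
    using T_ind[OF that] unfolding t_def by linarith+
  have T0: "T (\<lambda>_. 0) = 0" using TD(2)[of "\<lambda>_. 0" 0] by simp
  define N where "N = measure_of (space M) (sets M) (\<lambda>A. ennreal (t A))"
  have emeasure_N: "emeasure N A = ennreal (t A)" if "A \<in> sets M" for A
    unfolding N_def
  proof (rule emeasure_measure_of_sigma)
    show pos: "positive (sets M) (\<lambda>A. ennreal (t A))"
      using T0 by (simp add: positive_def t_def indicator_def[abs_def])
    have additive: "additive (sets M) (\<lambda>A. ennreal (t A))"
      unfolding additive_def
    proof (intro ballI impI)
      fix A B assume AB: "A \<in> sets M" "B \<in> sets M" "A \<inter> B = {}"
      have "(indicator (A \<union> B) :: 'a \<Rightarrow> real) = (\<lambda>x. indicator A x + indicator B x)"
        using AB(3) by (auto simp: fun_eq_iff indicator_def)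
      then have "t (A \<union> B) = t A + t B"
        using TD(1)[OF ind ind, OF AB(1,2)] finite_measure_Union[OF AB]
        by (simp add: t_def algebra_simps)
      then show "ennreal (t (A \<union> B)) = ennreal (t A) + ennreal (t B)"
        using t_bounds(1) AB by simp
    qed
    show "countably_additive (sets M) (\<lambda>A. ennreal (t A))"
    proof (rule sets.empty_continuous_imp_countably_additive[OF pos additive])
      fix A :: "nat \<Rightarrow> 'a set"
      assume A: "range A \<subseteq> sets M" "decseq A" "(\<Inter>i. A i) = {}"
      \<comment> \<open>The upper bound in \<open>t_bounds\<close> makes \<open>t\<close> continuous
        at the empty set, which upgrades additivity to countable additivity.\<close>
      have "(\<lambda>i. measure M (A i)) \<longlonglongrightarrow> 0"
        using finite_Lim_measure_decseq[OF A(1,2)] A(3) by simp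
      then have "(\<lambda>i. 2 * C * measure M (A i)) \<longlonglongrightarrow> 0"
        by (rule tendsto_mult_right_zero)
      then have "(\<lambda>i. t (A i)) \<longlonglongrightarrow> 0"
        using A(1) t_bounds by (intro tendsto_sandwich[of "\<lambda>_. 0" "\<lambda>i. t (A i)"]) auto
      then show "(\<lambda>i. ennreal (t (A i))) \<longlonglongrightarrow> 0"
        by (metis ennreal_0 tendsto_ennrealI)
    qed simp
  qed (use that in \<open>auto simp: sets.sigma_algebra_axioms\<close>)
  have sets_N: "sets N = sets M" unfolding N_def by simp
  have "absolutely_continuous M N"
    unfolding absolutely_continuous_def
  proof
    fix A assume A: "A \<in> null_sets M"
    then have "measure M A = 0" "A \<in> sets M" by (auto simp: null_sets_def measure_def)
    with t_bounds[of A] have "t A = 0" by simp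
    then show "A \<in> null_sets N"
      using \<open>A \<in> sets M\<close> emeasure_N sets_N by (simp add: null_sets_def)
  qed
  from Radon_Nikodym[OF this sets_N] obtain k
    where k: "k \<in> borel_measurable M" "density M k = N"
    by (rule bexE) (rule that)
  have nn_k: "(\<integral>\<^sup>+x. k x * indicator A x \<partial>M) = ennreal (t A)" if "A \<in> sets M" for A
    using emeasure_N[OF that] emeasure_density[OF k(1) that] unfolding k(2) by simp
  have "(\<integral>\<^sup>+x. k x \<partial>M) = ennreal (t (space M))"
    using nn_k[of "space M"] by (simp cong: nn_integral_cong)
  then have k_fin: "AE x in M. k x \<noteq> \<infinity>"
    using k(1) by (intro nn_integral_PInf_AE) auto
  \<comment> \<open>The density \<open>k\<close> has finite total mass, so it is finite almost
    everywhere and agrees there with a real function.\<close>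
  define r where "r x = enn2real (k x)" for x
  have r_meas [measurable]: "r \<in> borel_measurable M" unfolding r_def using k(1) by simp
  have k_r: "AE x in M. k x = ennreal (r x)"
    using k_fin by eventually_elim (simp add: r_def top.not_eq_extremum)
  have nn_r: "(\<integral>\<^sup>+x. ennreal (indicator A x * r x) \<partial>M) = ennreal (t A)" if "A \<in> sets M" for A
    unfolding nn_k[OF that, symmetric]
    using k_r by (intro nn_integral_cong_AE, eventually_elim) (auto split: split_indicator)
  have r_pos: "0 \<le> r x" for x by (simp add: r_def)
  have r_int: "has_bochner_integral M (\<lambda>x. indicator A x * r x) (t A)" if "A \<in> sets M" for A
    using that t_bounds(1)[OF that] r_pos
    by (intro has_bochner_integral_nn_integral nn_r) auto
  have r_integrable: "integrable M r"
    using r_int[of "space M"]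
    by (auto simp: has_bochner_integral_iff cong: Bochner_Integration.integrable_cong)
  define f\<^sub>0 where "f\<^sub>0 x = r x - C" for x
  have f0_integrable: "integrable M f\<^sub>0" unfolding f\<^sub>0_def using r_integrable by simp
  have f0_ind: "(LINT x|M. indicator A x * f\<^sub>0 x) = T (indicator A)" if A: "A \<in> sets M" for A
  proof -
    have "(LINT x|M. indicator A x * f\<^sub>0 x) = (LINT x|M. indicator A x * r x - C * indicator A x)"
      unfolding f\<^sub>0_def by (simp add: algebra_simps)
    also have "\<dots> = t A - C * measure M A"
      using r_int[OF A] ind[OF A] A sets.sets_into_space[OF A]
      by (simp add: has_bochner_integral_iff Int_absorb2)
    finally show ?thesis by (simp add: t_def)
  qed
  \<comment> \<open>The mean of \<open>f\<^sub>0\<close> over \<open>A\<close> is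
    \<open>T (indicator A) / measure M A\<close>, which lies in the interval by the bound on
    \<open>T\<close>. A function whose means all lie in a closed set takes almost all its values
    there.\<close>
  have "AE x in M. f\<^sub>0 x \<in> {-C..C}"
  proof (rule averaging_theorem[OF f0_integrable closed_atLeastAtMost])
    fix A assume "A \<in> sets M" "measure M A > 0"
    then show "(1 / measure M A) *\<^sub>R set_lebesgue_integral M A f\<^sub>0 \<in> {-C..C}"
      using T_ind[of A] f0_ind[of A]
      by (simp add: set_lebesgue_integral_def abs_le_iff field_simps)
  qed
  \<comment> \<open>The bound on \<open>f\<^sub>0\<close> holds only almost everywhere; clipping
    makes it hold at every point.\<close>
  define f where "f x = max (-C) (min C (f\<^sub>0 x))" for x
  have f_meas [measurable]: "f \<in> borel_measurable M" unfolding f_def f\<^sub>0_def by simp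
  have f_bound: "\<bar>f x\<bar> \<le> C" for x unfolding f_def using C by (auto simp: max_def min_def)
  have f_f0: "AE x in M. f x = f\<^sub>0 x"
    using \<open>AE x in M. f\<^sub>0 x \<in> {-C..C}\<close> by eventually_elim (simp add: f_def)
  have f_ind: "(LINT x|M. f x * indicator A x) = T (indicator A)" if A: "A \<in> sets M" for A
  proof -
    have "(LINT x|M. f x * indicator A x) = (LINT x|M. indicator A x * f\<^sub>0 x)"
      using f_f0 A borel_measurable_integrable[OF f0_integrable] by (intro integral_cong_AE) (auto simp: mult.commute)
    then show ?thesis using f0_ind[OF A] by simp
  qed
  have f_int: "integrable M (\<lambda>x. f x * g x)" if "integrable M g" for g
  proof (rule Bochner_Integration.integrable_bound)
    show "integrable M (\<lambda>x. C * g x)" using that by simp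
    show "AE x in M. norm (f x * g x) \<le> norm (C * g x)"
      using f_bound C by (intro AE_I2) (simp add: abs_mult mult_right_mono)
  qed (use that in simp)
  have "T g = (LINT x|M. f x * g x)" if "integrable M g" for g
    using that
  proof (induction rule: integrable_induct)
    case (base A c)
    then show ?case
      using TD(2)[OF ind[OF base(1)], of c] f_ind[OF base(1)]
      by (simp add: mult.commute[of _ c] mult.left_commute[of _ c])
  next
    case (add g h)
    then show ?case
      using TD(1)[OF add.hyps(1,2)] f_int by (simp add: distrib_left)
  next
    \<comment> \<open>The approximants \<open>s i\<close> supplied by
      \<open>integrable_induct\<close> are bounded by \<open>2 * \<bar>g x\<bar>\<close>, which
      explains the dominating functions below.\<close>
    case (lim g s)
    have "(\<lambda>i. T (s i)) \<longlonglongrightarrow> T g"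
      using lim.hyps by (intro bounded_L1_functional_tendsto[OF T, where w="\<lambda>x. 2 * \<bar>g x\<bar>"]) simp_all
    moreover have "(\<lambda>i. LINT x|M. f x * s i x) \<longlonglongrightarrow> (LINT x|M. f x * g x)"
    proof (rule integral_dominated_convergence[where w="\<lambda>x. C * (2 * \<bar>g x\<bar>)"])
      show "AE x in M. norm (f x * s i x) \<le> C * (2 * \<bar>g x\<bar>)" for i
      proof (rule AE_I2)
        fix x assume "x \<in> space M"
        then show "norm (f x * s i x) \<le> C * (2 * \<bar>g x\<bar>)"
          using mult_mono[OF f_bound[of x], of "\<bar>s i x\<bar>" "2 * \<bar>g x\<bar>"] lim.hyps(3)[of x i] C
          by (simp add: abs_mult)
      qed
      show "AE x in M. (\<lambda>i. f x * s i x) \<longlonglongrightarrow> f x * g x"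
        using lim.hyps(2) by (intro AE_I2 tendsto_mult tendsto_const)
    qed (use lim.hyps(1,4) in simp_all)
    ultimately show ?case using lim.IH LIMSEQ_unique by simp
  qed
  then show thesis by (rule that[OF f_meas f_bound])
qed

text \<open>A strictly positive integrable weight \<open>w\<close> turns \<open>M\<close> into a
  finite measure \<open>N\<close>, and multiplication by \<open>w\<close> is an isometry from L1 of
  \<open>N\<close> onto L1 of \<open>M\<close>. The density found for \<open>N\<close> also works
  for \<open>M\<close>, because the factor \<open>w\<close> cancels against the division of
  \<open>g\<close> by \<open>w\<close>.\<close>

theorem (in sigma_finite_measure) L1_dual:
  assumes T: "bounded_L1_functional M C T" and C: "0 \<le> C"
  obtains f where "f \<in> borel_measurable M" "\<And>x. \<bar>f x\<bar> \<le> C"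
    "\<And>g. integrable M g \<Longrightarrow> T g = (LINT x|M. f x * g x)"
proof -
  obtain w :: "'a \<Rightarrow> real" where w: "w \<in> borel_measurable M" "\<And>x. 0 < w x" "integrable M w"
    by (rule obtain_positive_integrable_function) (rule that)
  define N where "N = density M w"
  have w_nn: "AE x in M. 0 \<le> w x" using w(2) by (simp add: less_imp_le)
  have int_N: "integrable N h \<longleftrightarrow> integrable M (\<lambda>x. w x * h x)" 
    and integral_N: "integral\<^sup>L N h = (LINT x|M. w x * h x)"
    if "h \<in> borel_measurable M" for h :: "'a \<Rightarrow> real"
    unfolding N_def using that w(1) w_nn by (simp_all add: integrable_density integral_density)
  have meas_N: "h \<in> borel_measurable M" if "integrable N h" for h :: "'a \<Rightarrow> real"
    using borel_measurable_integrable[OF that] by (simp add: N_def)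
  have int_w: "integrable M (\<lambda>x. w x * h x)" if "integrable N h" for h :: "'a \<Rightarrow> real"
    using int_N[OF meas_N[OF that]] that by blast
  have "emeasure N (space N) = (\<integral>\<^sup>+x. ennreal (w x) \<partial>M)"
    unfolding N_def using w(1) by (simp add: emeasure_density cong: nn_integral_cong)
  also have "\<dots> = ennreal (integral\<^sup>L M w)"
    by (rule nn_integral_eq_integral[OF w(3) w_nn])
  finally have "emeasure N (space N) \<noteq> \<infinity>" by simp
  then interpret N: finite_measure N by (rule finite_measureI)
  have "bounded_L1_functional N C (\<lambda>h. T (\<lambda>x. w x * h x))"
    unfolding bounded_L1_functional_def
  proof (intro conjI allI impI)
    fix g h :: "'a \<Rightarrow> real" assume "integrable N g" "integrable N h"
    then show "T (\<lambda>x. w x * (g x + h x)) = T (\<lambda>x. w x * g x) + T (\<lambda>x. w x * h x)"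
      using bounded_L1_functionalD(1)[OF T int_w int_w] by (simp add: distrib_left)
  next
    fix c and g :: "'a \<Rightarrow> real" assume "integrable N g"
    then show "T (\<lambda>x. w x * (c * g x)) = c * T (\<lambda>x. w x * g x)"
      using bounded_L1_functionalD(2)[OF T int_w] by (simp add: mult.left_commute)
  next
    fix g :: "'a \<Rightarrow> real" assume g: "integrable N g"
    have "integral\<^sup>L N (\<lambda>x. \<bar>g x\<bar>) = (LINT x|M. \<bar>w x * g x\<bar>)"
      using meas_N[OF g] w(2) by (simp add: integral_N abs_mult abs_of_pos)
    then show "\<bar>T (\<lambda>x. w x * g x)\<bar> \<le> C * (LINT x|N. \<bar>g x\<bar>)"
      using bounded_L1_functionalD(3)[OF T int_w[OF g]] by simp
  qed
  then obtain f where f: "f \<in> borel_measurable N" "\<And>x. \<bar>f x\<bar> \<le> C"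
    "\<And>h. integrable N h \<Longrightarrow> T (\<lambda>x. w x * h x) = (LINT x|N. f x * h x)"
    using C by (rule N.L1_dual_finite_measure) blast
  have f_meas: "f \<in> borel_measurable M" using f(1) by (simp add: N_def)
  have "T g = (LINT x|M. f x * g x)" if g: "integrable M g" for g
  proof -
    have gw: "(\<lambda>x. g x / w x) \<in> borel_measurable M" using w(1) g by simp
    have cancel: "w x * (g x / w x) = g x" "w x * (f x * (g x / w x)) = f x * g x" for x
      using w(2)[of x] by simp_all
    have "T g = (LINT x|N. f x * (g x / w x))"
      using f(3)[of "\<lambda>x. g x / w x"] int_N[OF gw] g unfolding cancel by blast
    moreover have "(\<lambda>x. f x * (g x / w x)) \<in> borel_measurable M"
      using gw f_meas by (rule borel_measurable_times[rotated])
    ultimately show ?thesis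
      using integral_N[of "\<lambda>x. f x * (g x / w x)"] unfolding cancel by simp
  qed
  then show thesis by (rule that[OF f_meas f(2)])
qed

subsection \<open>Approximation in the mean and the extension of the distribution\<close>

text \<open>Inner regularity provides a closed set at a loss below \<open>e / 2\<close>. Cutting it
  with large balls makes it compact; as its measure is finite, continuity from below keeps this
  second loss under \<open>e / 2\<close>.\<close>

lemma lmeasurable_inner_compact:
  fixes A :: "'a::euclidean_space set"
  assumes A: "A \<in> lmeasurable" and e: "0 < e"
  obtains K where "compact K" "K \<subseteq> A" "measure lebesgue (A - K) < e"
proof -
  obtain T where T: "closed T" "T \<subseteq> A" "A - T \<in> lmeasurable" "emeasure lebesgue (A - T) < ennreal (e / 2)"
    by (rule sets_lebesgue_inner_closed[of A "e / 2"]) (use A e fmeasurableD in auto)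
  have T_meas: "T \<in> lmeasurable"
    by (rule fmeasurableI2[OF A T(2)]) (use T(1) in simp)
  define K where "K n = T \<inter> cball 0 (real n)" for n
  have K_meas: "K n \<in> lmeasurable" for n
    unfolding K_def by (intro fmeasurable_Int_fmeasurable T_meas fmeasurableD lmeasurable_cball)
  have "T \<subseteq> (\<Union>n. K n)"
    unfolding K_def using real_arch_simple by (auto simp: mem_cball_0)
  then have UN_K: "(\<Union>n. K n) = T" unfolding K_def by auto
  have "(\<lambda>n. measure lebesgue (K n)) \<longlonglongrightarrow> measure lebesgue (\<Union>n. K n)"
  proof (rule Lim_measure_incseq)
    show "range K \<subseteq> sets lebesgue" using K_meas fmeasurableD by blast
    show "incseq K" unfolding K_def by (auto simp: incseq_def)
    show "emeasure lebesgue (\<Union>n. K n) \<noteq> \<infinity>" using fmeasurableD2[OF T_meas] unfolding UN_K by simp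
  qed
  then have "(\<lambda>n. measure lebesgue (K n)) \<longlonglongrightarrow> measure lebesgue T" unfolding UN_K .
  from LIMSEQ_D[OF this, of "e / 2"] e obtain n
    where n: "\<bar>measure lebesgue (K n) - measure lebesgue T\<bar> < e / 2" by auto
  show thesis
  proof
    show "compact (K n)" unfolding K_def using T(1) by (simp add: closed_Int_compact)
    show "K n \<subseteq> A" unfolding K_def using T(2) by auto
    have "measure lebesgue (A - T) < e / 2"
      using T(3,4) e by (simp add: emeasure_eq_measure2 ennreal_less_iff)
    moreover have "measure lebesgue (A - T) = measure lebesgue A - measure lebesgue T"
      using A T_meas T(2) by (rule measurable_measure_Diff[OF _ fmeasurableD])
    moreover have "measure lebesgue (A - K n) = measure lebesgue A - measure lebesgue (K n)"
      using A K_meas \<open>K n \<subseteq> A\<close> by (intro measurable_measure_Diff fmeasurableD)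
    ultimately show "measure lebesgue (A - K n) < e" using n by linarith
  qed
qed

lemma real_tests_integrable:
  fixes g :: "real ^ 'd::finite \<Rightarrow> real"
  assumes "g \<in> real_tests U"
  shows "integrable lebesgue g"
proof -
  obtain K where K: "compact K" "\<And>x. x \<notin> K \<Longrightarrow> g x = 0"
    using assms by (rule real_testsE) (rule that)
  have cont: "continuous_on S g" for S using assms by (rule real_tests_continuous_on)
  have "(\<lambda>x. indicator K x *\<^sub>R g x) = g"
    by (rule ext) (use K(2) in \<open>auto simp: indicator_def\<close>)
  then have "integrable lborel g"
    using borel_integrable_compact[OF K(1) cont] by simp
  moreover have "g \<in> borel_measurable lborel"
    using borel_measurable_continuous_onI[OF cont] by simp
  ultimately show ?thesis by (simp add: integrable_completion)
qed

text \<open>Duality takes place over \<open>lebesgue_on U\<close>, regularity of sets and the bounds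
  on \<open>F\<close> over \<open>lebesgue\<close>. Functions that vanish off \<open>U\<close> pass
  freely between the two.\<close>

lemma lebesgue_on_vanishing_outside:
  fixes h :: "'a::euclidean_space \<Rightarrow> real"
  assumes "U \<in> sets lebesgue" "\<And>x. x \<notin> U \<Longrightarrow> h x = 0"
  shows "integrable (lebesgue_on U) h \<longleftrightarrow> integrable lebesgue h"
    and "integral\<^sup>L (lebesgue_on U) h = integral\<^sup>L lebesgue h"
proof -
  have "(\<lambda>x. indicator U x *\<^sub>R h x) = h"
    by (rule ext) (use assms(2) in \<open>auto simp: indicator_def\<close>)
  then show "integrable (lebesgue_on U) h \<longleftrightarrow> integrable lebesgue h"
    and "integral\<^sup>L (lebesgue_on U) h = integral\<^sup>L lebesgue h"
    using assms(1) by (simp_all add: integrable_restrict_space integral_restrict_space)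
qed

lemma real_tests_vanish_outside: "g \<in> real_tests U \<Longrightarrow> x \<notin> U \<Longrightarrow> g x = 0"
  by (elim real_testsE) blast

text \<open>Squeeze \<open>A\<close> between a compact \<open>K\<close> and an open \<open>W\<close>
  inside \<open>U\<close>, and approximately truncate at 1 a test function of \<open>W\<close> that
  is at least 1 on \<open>K\<close>. The result is close to 1 on \<open>K\<close> and 0 off
  \<open>W\<close>; elsewhere it is merely bounded, but that region has small measure.\<close>

lemma real_tests_approx_indicator:
  fixes A U :: "(real ^ 'd::finite) set"
  assumes U: "open U" and A: "A \<in> lmeasurable" "A \<subseteq> U" and e: "0 < e"
  obtains h where "h \<in> real_tests U" "(LINT x|lebesgue. \<bar>indicator A x - h x\<bar>) < e"
proof -
  \<comment> \<open>As \<open>\<delta> \<le> 1\<close>, the error is at most 2 on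
    \<open>W - A\<close> and on \<open>A - K\<close>, both of measure below \<open>\<delta>\<close>;
    this accounts for the 4. On \<open>K\<close> the error is below \<open>\<delta>\<close>, which
    accounts for the measure of \<open>A\<close>.\<close>
  define \<delta> where "\<delta> = min 1 (e / (measure lebesgue A + 4))"
  have \<delta>: "0 < \<delta>" "\<delta> \<le> 1" "\<delta> * (measure lebesgue A + 4) \<le> e"
  proof -
    have pos: "0 < measure lebesgue A + 4" by (simp add: add_nonneg_pos)
    then show "0 < \<delta>" "\<delta> \<le> 1" using e unfolding \<delta>_def by simp_all
    have "\<delta> \<le> e / (measure lebesgue A + 4)" unfolding \<delta>_def by simp
    then show "\<delta> * (measure lebesgue A + 4) \<le> e" using pos by (simp add: pos_le_divide_eq)
  qed
  obtain K where K: "compact K" "K \<subseteq> A" "measure lebesgue (A - K) < \<delta>"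
    using lmeasurable_inner_compact[OF A(1) \<delta>(1)] by blast
  obtain V where V: "open V" "A \<subseteq> V" "V - A \<in> lmeasurable" "emeasure lebesgue (V - A) < ennreal \<delta>"
    using sets_lebesgue_outer_open[OF fmeasurableD[OF A(1)] \<delta>(1)] by blast
  define W where "W = V \<inter> U"
  have W: "open W" "A \<subseteq> W" "W \<subseteq> U" using U V A unfolding W_def by auto
  have WA: "W - A \<in> lmeasurable"
    by (rule fmeasurableI2[OF V(3)]) (use W(1) A(1) in \<open>auto simp: W_def fmeasurableD\<close>)
  have "measure lebesgue (W - A) \<le> measure lebesgue (V - A)"
    using WA V(3) unfolding W_def by (intro measure_mono_fmeasurable fmeasurableD) auto
  also have "\<dots> < \<delta>"
    using V(3,4) \<delta>(1) by (simp add: emeasure_eq_measure2 ennreal_less_iff)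
  finally have WA_small: "measure lebesgue (W - A) < \<delta>" .
  have AK: "A - K \<in> lmeasurable"
    by (rule fmeasurable_Diff[OF A(1) fmeasurableD[OF lmeasurable_compact[OF K(1)]]])
  obtain g where g: "g \<in> real_tests W" "\<And>x. 0 \<le> g x" "\<And>x. x \<in> K \<Longrightarrow> 1 \<le> g x"
    using real_tests_ge_1_on_compact[OF K(1) W(1)] K(2) W(2) by blast
  have "continuous_on UNIV (min (1::real))" by (intro continuous_intros)
  then obtain h where h: "h \<in> real_tests W" "\<And>x. \<bar>h x - min 1 (g x)\<bar> < \<delta>" "\<And>x. g x = 0 \<Longrightarrow> h x = 0"
    by (rule real_tests_approx_compose[OF g(1)]) (use \<delta>(1) in auto)
  have bound: "\<bar>indicator A x - h x\<bar> \<le>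
      2 * indicator (W - A) x + 2 * indicator (A - K) x + \<delta> * indicator A x" for x
  proof -
    consider "x \<notin> W" | "x \<in> W - A" | "x \<in> A - K" | "x \<in> K" using K(2) W(2) by blast
    then show ?thesis
    proof cases
      case 1
      then show ?thesis
        using real_tests_vanish_outside[OF h(1)] W(2) K(2) by (auto simp: indicator_def)
    next
      case 2
      then show ?thesis using h(2)[of x] g(2)[of x] \<delta>(2) by (auto simp: indicator_def abs_le_iff min_def split: if_splits)
    next
      case 3
      then show ?thesis using h(2)[of x] g(2)[of x] \<delta> W(2) by (auto simp: indicator_def abs_le_iff min_def split: if_splits)
    next
      case 4
      then show ?thesis using h(2)[of x] g(3)[of x] K(2) W(2) by (auto simp: indicator_def)
    qed
  qed
  have ind: "integrable lebesgue (indicator B :: _ \<Rightarrow> real)"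
    "(LINT x|lebesgue. indicator B x) = measure lebesgue B" if "B \<in> lmeasurable" for B :: "(real ^ 'd) set"
    using that by (auto simp: lmeasurable_iff_integrable lmeasure_integral)
  have "(LINT x|lebesgue. \<bar>indicator A x - h x\<bar>) \<le>
      (LINT x|lebesgue. 2 * indicator (W - A) x + 2 * indicator (A - K) x + \<delta> * indicator A x)"
    using bound ind(1)[OF WA] ind(1)[OF AK] ind(1)[OF A(1)] real_tests_integrable[OF h(1)]
    by (intro integral_mono) auto
  also have "\<dots> = 2 * measure lebesgue (W - A) + 2 * measure lebesgue (A - K) + \<delta> * measure lebesgue A"
    using ind[OF WA] ind[OF AK] ind[OF A(1)] by simp
  also have "\<dots> < \<delta> * (measure lebesgue A + 4)"
    using WA_small K(3) by (simp add: distrib_left)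
  also have "\<dots> \<le> e" by fact
  finally show thesis
    using that real_tests_mono[OF W(3)] h(1) by blast
qed

lemma real_tests_dense_L1:
  fixes g :: "real ^ 'd::finite \<Rightarrow> real"
  assumes U: "open U" and g: "integrable (lebesgue_on U) g" and e: "0 < e"
  shows "\<exists>h\<in>real_tests U. (LINT x|lebesgue_on U. \<bar>g x - h x\<bar>) < e"
proof -
  have U_sets: "U \<in> sets lebesgue" using U by simp
  have tests_int: "integrable (lebesgue_on U) h" if "h \<in> real_tests U" for h
    using lebesgue_on_vanishing_outside(1)[OF U_sets, of h] real_tests_vanish_outside[OF that]
      real_tests_integrable[OF that] by blast
  \<comment> \<open>The tolerance is quantified inside the claim, since the induction hypotheses are
    invoked with smaller tolerances.\<close>
  have "\<forall>e>0. \<exists>h\<in>real_tests U. (LINT x|lebesgue_on U. \<bar>g x - h x\<bar>) < e"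
    using g
  proof (induction rule: integrable_induct)
    case (base A c)
    show ?case
    proof (intro allI impI)
      fix e :: real assume "0 < e"
      have A: "A \<subseteq> U" "A \<in> sets lebesgue"
        using base(1) U_sets by (auto simp: sets_restrict_space_iff)
      then have "A \<in> lmeasurable"
        using base(2) U_sets by (simp add: fmeasurable_def emeasure_restrict_space)
      moreover have "0 < e / (\<bar>c\<bar> + 1)" using \<open>0 < e\<close> by (simp add: add_nonneg_pos)
      ultimately obtain h where h: "h \<in> real_tests U"
        "(LINT x|lebesgue. \<bar>indicator A x - h x\<bar>) < e / (\<bar>c\<bar> + 1)"
        using real_tests_approx_indicator[OF U _ A(1)] by blast
      have outside: "indicator A x - h x = 0" if "x \<notin> U" for x
        using real_tests_vanish_outside[OF h(1) that] A(1) that by (auto simp: indicator_def)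
      have scale: "\<bar>indicator A x *\<^sub>R c - c * h x\<bar> = \<bar>c\<bar> * \<bar>indicator A x - h x\<bar>" for x
        by (simp add: mult.commute[of _ c] flip: right_diff_distrib abs_mult)
      have "(LINT x|lebesgue_on U. \<bar>indicator A x *\<^sub>R c - c * h x\<bar>) =
          \<bar>c\<bar> * (LINT x|lebesgue. \<bar>indicator A x - h x\<bar>)"
        unfolding scale using lebesgue_on_vanishing_outside(2)[OF U_sets, of "\<lambda>x. \<bar>indicator A x - h x\<bar>"] outside
        by simp
      also have "\<dots> \<le> \<bar>c\<bar> * (e / (\<bar>c\<bar> + 1))"
        using h(2) by (intro mult_left_mono) auto
      also have "\<dots> < e" using \<open>0 < e\<close> by (simp add: field_simps add_nonneg_pos)
      finally show "\<exists>h\<in>real_tests U. (LINT x|lebesgue_on U. \<bar>indicator A x *\<^sub>R c - h x\<bar>) < e"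
        using real_tests_scale[OF h(1), of c] by (rule bexI[where x="\<lambda>x. c * h x"])
    qed
  next
    case (add f g)
    show ?case
    proof (intro allI impI)
      fix e :: real assume "0 < e"
      then have "0 < e / 2" by simp
      with add.IH obtain h k where h: "h \<in> real_tests U" "(LINT x|lebesgue_on U. \<bar>f x - h x\<bar>) < e / 2"
        and k: "k \<in> real_tests U" "(LINT x|lebesgue_on U. \<bar>g x - k x\<bar>) < e / 2"
        by blast
      note int = add.hyps tests_int[OF h(1)] tests_int[OF k(1)]
      have "(LINT x|lebesgue_on U. \<bar>(f x + g x) - (h x + k x)\<bar>) \<le>
          (LINT x|lebesgue_on U. \<bar>f x - h x\<bar> + \<bar>g x - k x\<bar>)"
        using int by (intro integral_mono) auto
      also have "\<dots> = (LINT x|lebesgue_on U. \<bar>f x - h x\<bar>) + (LINT x|lebesgue_on U. \<bar>g x - k x\<bar>)"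
        using int by (intro Bochner_Integration.integral_add) auto
      also have "\<dots> < e" using h(2) k(2) by simp
      finally show "\<exists>h\<in>real_tests U. (LINT x|lebesgue_on U. \<bar>(f x + g x) - h x\<bar>) < e"
        using real_tests_add[OF h(1) k(1)] by (rule bexI[where x="\<lambda>x. h x + k x"])
    qed
  next
    case (lim f s)
    have "(\<lambda>i. LINT x|lebesgue_on U. \<bar>f x - s i x\<bar>) \<longlonglongrightarrow> (LINT x|lebesgue_on U. (0::real))"
    proof (rule integral_dominated_convergence)
      \<comment> \<open>The factor 3 is 1 for \<open>f\<close> itself plus 2 from the bound on the
        approximants.\<close>
      show "integrable (lebesgue_on U) (\<lambda>x. 3 * \<bar>f x\<bar>)" using lim.hyps(4) by simp
      show "AE x in lebesgue_on U. (\<lambda>i. \<bar>f x - s i x\<bar>) \<longlonglongrightarrow> 0"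
      proof (rule AE_I2)
        fix x assume "x \<in> space (lebesgue_on U)"
        from tendsto_rabs[OF tendsto_diff[OF tendsto_const[of "f x"] lim.hyps(2)[OF this]]]
        show "(\<lambda>i. \<bar>f x - s i x\<bar>) \<longlonglongrightarrow> 0" by simp
      qed
      show "AE x in lebesgue_on U. norm \<bar>f x - s i x\<bar> \<le> 3 * \<bar>f x\<bar>" for i
      proof (rule AE_I2)
        fix x assume "x \<in> space (lebesgue_on U)"
        from lim.hyps(3)[OF this, of i] show "norm \<bar>f x - s i x\<bar> \<le> 3 * \<bar>f x\<bar>"
          unfolding real_norm_def by linarith
      qed
    qed (use borel_measurable_integrable[OF lim.hyps(1)] borel_measurable_integrable[OF lim.hyps(4)] in simp_all)
    then have L1: "(\<lambda>i. LINT x|lebesgue_on U. \<bar>f x - s i x\<bar>) \<longlonglongrightarrow> 0" by simp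
    show ?case
    proof (intro allI impI)
      fix e :: real assume "0 < e"
      then have e2: "0 < e / 2" by simp
      have "\<forall>\<^sub>F i in sequentially. (LINT x|lebesgue_on U. \<bar>f x - s i x\<bar>) < e / 2"
        by (rule order_tendstoD(2)[OF L1 e2])
      then obtain i where i: "(LINT x|lebesgue_on U. \<bar>f x - s i x\<bar>) < e / 2"
        using eventually_happens'[OF sequentially_bot] by blast
      obtain h where h: "h \<in> real_tests U" "(LINT x|lebesgue_on U. \<bar>s i x - h x\<bar>) < e / 2"
        using lim.IH[of i] e2 by blast
      show "\<exists>h\<in>real_tests U. (LINT x|lebesgue_on U. \<bar>f x - h x\<bar>) < e"
        using L1_dist_triangle[OF lim.hyps(4) lim.hyps(1)[of i] tests_int[OF h(1)]] i h
        by (intro bexI[of _ h]) linarith+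
    qed
  qed
  then show ?thesis using e by blast
qed

section \<open>From normalized test functions to a bound in the mean\<close>

lemma distribution_add:
  "distribution F \<Longrightarrow> \<phi> \<in> test_functions_on U \<Longrightarrow> \<psi> \<in> test_functions_on U \<Longrightarrow>
    F (\<lambda>x. \<phi> x + \<psi> x) = F \<phi> + F \<psi>"
  and distribution_scale:
  "distribution F \<Longrightarrow> \<phi> \<in> test_functions_on U \<Longrightarrow> F (\<lambda>x. c * \<phi> x) = c * F \<phi>"
  unfolding distribution_def test_functions_on_def by simp_all

text \<open>Division by the integral normalizes \<open>g\<close>. This fails only for integral 0,
  and then the nonnegative continuous \<open>g\<close> vanishes identically: its zero set is closed
  and has full measure.\<close>

lemma distribution_bound_nonneg:
  fixes U :: "(real ^ 'd::finite) set"
  assumes F: "distribution F"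
    and M: "\<And>\<phi>. \<phi> \<in> test_functions_on U \<Longrightarrow> positive_fun \<phi> \<Longrightarrow> normalized \<phi> \<Longrightarrow> cmod (F \<phi>) \<le> M"
    and g: "g \<in> real_tests U" "\<And>x. 0 \<le> g x"
  shows "cmod (F (\<lambda>x. complex_of_real (g x))) \<le> M * integral\<^sup>L lebesgue g"
proof -
  define c where "c = integral\<^sup>L lebesgue g"
  have G: "(\<lambda>x. complex_of_real (g x)) \<in> test_functions_on U" using g(1) by (simp add: real_tests_def)
  have "0 \<le> c" unfolding c_def using g(2) by (intro integral_nonneg_AE) simp
  then consider "c = 0" | "0 < c" by linarith
  then show ?thesis
  proof cases
    case 1
    then have "AE x in lebesgue. g x = 0"
      using integral_nonneg_eq_0_iff_AE[OF real_tests_integrable[OF g(1)]] g(2) by (simp add: c_def)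
    moreover have "closed {x. g x = 0}"
      by (intro closed_Collect_eq continuous_on_const real_tests_continuous_on[OF g(1)])
    ultimately have "g x = 0" for x
      using mem_closed_if_AE_lebesgue[of "{x. g x = 0}" x] by simp
    then show ?thesis using distribution_scale[OF F G, of 0] 1 by (simp flip: c_def)
  next
    case 2
    define \<phi> where "\<phi> = (\<lambda>x. complex_of_real (1 / c * g x))"
    have "\<phi> \<in> test_functions_on U"
      using real_tests_scale[OF g(1), of "1 / c"] by (simp add: real_tests_def \<phi>_def)
    moreover have "positive_fun \<phi>" using g(2) 2 by (simp add: positive_fun_def \<phi>_def)
    moreover have "(LINT x|lebesgue. 1 / c * g x) = 1"
      using 2 by (subst integral_mult_right_zero) (simp add: c_def)
    then have "normalized \<phi>" unfolding normalized_def \<phi>_def by (subst integral_complex_of_real) simp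
    ultimately have "cmod (F \<phi>) \<le> M" by (rule M)
    moreover have "F \<phi> = of_real (1 / c) * F (\<lambda>x. complex_of_real (g x))"
      unfolding \<phi>_def of_real_mult by (rule distribution_scale[OF F G])
    ultimately show ?thesis
      using 2 by (simp add: norm_mult norm_divide field_simps flip: c_def)
  qed
qed

text \<open>The positive part of \<open>g\<close> need not be smooth, but it has smooth majorants of almost the same
  integral, since the one-sided error can be absorbed by a bump function.\<close>

lemma distribution_L1_bound:
  fixes U :: "(real ^ 'd::finite) set"
  assumes F: "distribution F" and U: "open U" and M0: "0 < M"
    and M: "\<And>\<phi>. \<phi> \<in> test_functions_on U \<Longrightarrow> positive_fun \<phi> \<Longrightarrow> normalized \<phi> \<Longrightarrow> cmod (F \<phi>) \<le> M"
    and g: "g \<in> real_tests U"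
  shows "cmod (F (\<lambda>x. complex_of_real (g x))) \<le> M * (LINT x|lebesgue. \<bar>g x\<bar>)"
proof (rule field_le_epsilon)
  fix e :: real assume "0 < e"
  obtain K where K: "compact K" "K \<subseteq> U" "\<And>x. x \<notin> K \<Longrightarrow> g x = 0"
    using g by (rule real_testsE) (rule that)
  obtain \<beta> where \<beta>: "\<beta> \<in> real_tests U" "\<And>x. 0 \<le> \<beta> x" "\<And>x. x \<in> K \<Longrightarrow> 1 \<le> \<beta> x"
    using real_tests_ge_1_on_compact[OF K(1) U K(2)] by blast
  define I where "I = integral\<^sup>L lebesgue \<beta>"
  have I: "0 \<le> I" unfolding I_def using \<beta>(2) by (intro integral_nonneg_AE) simp
  \<comment> \<open>\<open>4 * \<delta> * I\<close> is the excess of the integral of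
    \<open>p + n\<close> over that of the absolute value of \<open>g\<close>: both \<open>p\<close>
    and \<open>n\<close> exceed the respective part of \<open>g\<close> by at most
    \<open>2 * \<delta> * \<beta> x\<close>. The summand 1 covers \<open>I = 0\<close>.\<close>
  define \<delta> where "\<delta> = e / (4 * M * I + 1)"
  have \<delta>: "0 < \<delta>" "M * (4 * \<delta> * I) \<le> e"
  proof -
    have pos: "0 < 4 * M * I + 1" using M0 I by (simp add: add_nonneg_pos)
    then show \<delta>_pos: "0 < \<delta>" unfolding \<delta>_def using \<open>0 < e\<close> by simp
    have "\<delta> * (4 * M * I + 1) = e" unfolding \<delta>_def using pos by simp
    moreover have "M * (4 * \<delta> * I) = \<delta> * (4 * M * I + 1) - \<delta>" by (simp add: algebra_simps)
    ultimately show "M * (4 * \<delta> * I) \<le> e" using \<delta>_pos by simp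
  qed
  have "continuous_on UNIV (max (0::real))" by (intro continuous_intros)
  then obtain h where h: "h \<in> real_tests U" "\<And>x. \<bar>h x - max 0 (g x)\<bar> < \<delta>" "\<And>x. g x = 0 \<Longrightarrow> h x = 0"
    by (rule real_tests_approx_compose[OF g]) (use \<delta>(1) in auto)
  \<comment> \<open>\<open>h\<close> may fall below the positive part by \<open>\<delta>\<close>,
    but only on \<open>K\<close>, where \<open>\<beta> x \<ge> 1\<close> compensates. Then
    \<open>p\<close> also majorizes \<open>g\<close>, so the difference \<open>n\<close> is
    nonnegative.\<close>
  define p where "p x = h x + \<delta> * \<beta> x" for x
  define n where "n x = p x + - 1 * g x" for x
  have p: "p \<in> real_tests U" unfolding p_def by (intro real_tests_add real_tests_scale h(1) \<beta>(1))
  have n: "n \<in> real_tests U" unfolding n_def by (intro real_tests_add real_tests_scale p g)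
  have bounds: "max 0 (g x) \<le> p x" "p x \<le> max 0 (g x) + 2 * \<delta> * \<beta> x" for x
  proof -
    have "max 0 (g x) \<le> p x \<and> p x \<le> max 0 (g x) + 2 * \<delta> * \<beta> x"
    proof (cases "x \<in> K")
      case True
      have "\<delta> \<le> \<delta> * \<beta> x" using \<beta>(3)[OF True] \<delta>(1) by simp
      then show ?thesis using h(2)[of x] unfolding p_def by linarith
    next
      case False
      then show ?thesis using K(3)[OF False] h(3)[of x] \<delta>(1) \<beta>(2)[of x] unfolding p_def by simp
    qed
    then show "max 0 (g x) \<le> p x" "p x \<le> max 0 (g x) + 2 * \<delta> * \<beta> x" by auto
  qed
  have p_nonneg: "0 \<le> p x" for x using bounds(1)[of x] by linarith
  have Fp: "cmod (F (\<lambda>x. complex_of_real (p x))) \<le> M * integral\<^sup>L lebesgue p"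
    by (rule distribution_bound_nonneg[OF F _ p p_nonneg]) (rule M)
  have n_nonneg: "0 \<le> n x" for x using bounds(1)[of x] unfolding n_def by linarith
  have Fn: "cmod (F (\<lambda>x. complex_of_real (n x))) \<le> M * integral\<^sup>L lebesgue n"
    by (rule distribution_bound_nonneg[OF F _ n n_nonneg]) (rule M)
  have "F (\<lambda>x. complex_of_real (p x)) =
      F (\<lambda>x. complex_of_real (g x) + complex_of_real (n x))"
    unfolding n_def by simp
  also have "\<dots> = F (\<lambda>x. complex_of_real (g x)) + F (\<lambda>x. complex_of_real (n x))"
    using g n by (intro distribution_add[OF F]) (simp_all add: real_tests_def)
  finally have "F (\<lambda>x. complex_of_real (g x)) =
      F (\<lambda>x. complex_of_real (p x)) - F (\<lambda>x. complex_of_real (n x))" by simp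
  then have "cmod (F (\<lambda>x. complex_of_real (g x))) \<le>
      cmod (F (\<lambda>x. complex_of_real (p x))) + cmod (F (\<lambda>x. complex_of_real (n x)))"
    by (simp add: norm_triangle_ineq4)
  also have "\<dots> \<le> M * integral\<^sup>L lebesgue p + M * integral\<^sup>L lebesgue n"
    by (rule add_mono[OF Fp Fn])
  also have "\<dots> = M * (LINT x|lebesgue. p x + n x)"
    using real_tests_integrable[OF p] real_tests_integrable[OF n] by (simp add: distrib_left)
  also have "(LINT x|lebesgue. p x + n x) \<le> (LINT x|lebesgue. \<bar>g x\<bar> + 4 * \<delta> * \<beta> x)"
  proof (rule integral_mono)
    fix x
    show "p x + n x \<le> \<bar>g x\<bar> + 4 * \<delta> * \<beta> x"
      using bounds(2)[of x] unfolding n_def by linarith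
  qed (use real_tests_integrable[OF p] real_tests_integrable[OF n] real_tests_integrable[OF g]
      real_tests_integrable[OF \<beta>(1)] in auto)
  also have "\<dots> = (LINT x|lebesgue. \<bar>g x\<bar>) + 4 * \<delta> * I"
    using real_tests_integrable[OF g] real_tests_integrable[OF \<beta>(1)] by (simp add: I_def)
  finally show "cmod (F (\<lambda>x. complex_of_real (g x))) \<le> M * (LINT x|lebesgue. \<bar>g x\<bar>) + e"
    using M0 \<delta>(2) by (simp add: distrib_left)
qed

section \<open>The two implications of the equivalence\<close>

lemma sigma_finite_measure_lebesgue_on:
  fixes U :: "'a::euclidean_space set"
  assumes "U \<in> sets lebesgue"
  shows "sigma_finite_measure (lebesgue_on U)"
proof (rule sigma_finite_measure_restrict_space[OF _ assms])
  show "sigma_finite_measure (lebesgue :: 'a measure)"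
    by (rule sigma_finite_measure.intro, rule exI[where x="range (\<lambda>n::nat. cball 0 (real n))"])
      (use real_arch_simple emeasure_compact_finite[OF compact_cball] in
        \<open>auto simp: mem_cball_0 less_top[symmetric]\<close>)
qed

lemma real_tests_Re: "\<phi> \<in> test_functions_on U \<Longrightarrow> (\<lambda>x. Re (\<phi> x)) \<in> real_tests U"
  and real_tests_Im: "\<phi> \<in> test_functions_on U \<Longrightarrow> (\<lambda>x. Im (\<phi> x)) \<in> real_tests U"
proof -
  assume "\<phi> \<in> test_functions_on U"
  then obtain K where K: "smooth \<phi>" "compact K" "K \<subseteq> U" "\<And>x. x \<notin> K \<Longrightarrow> \<phi> x = 0"
    by (rule test_functions_onE) (rule that)
  have "bounded_linear (\<lambda>z. complex_of_real (Re z))" "bounded_linear (\<lambda>z. complex_of_real (Im z))"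
    by (intro bounded_linear_compose[OF bounded_linear_of_real] bounded_linear_Re bounded_linear_Im)+
  note smooth = this[THEN smooth_bounded_linear[OF K(1)]]
  show "(\<lambda>x. Re (\<phi> x)) \<in> real_tests U"
    by (rule real_testsI[OF smooth(1) K(2,3)]) (simp add: K(4))
  show "(\<lambda>x. Im (\<phi> x)) \<in> real_tests U"
    by (rule real_testsI[OF smooth(2) K(2,3)]) (simp add: K(4))
qed

text \<open>The integral of \<open>\<phi>\<close> is 1, so an essential bound for \<open>f\<close>
  passes to \<open>F \<phi>\<close>. The maximum with 1 makes the constant positive:
  \<open>C\<close> may be 0, or even negative if \<open>U\<close> is empty.\<close>

lemma regular_bounded_imp_bound:
  fixes U :: "(real ^ 'd::finite) set"
  assumes U: "open U" and C: "AE x in lebesgue_on U. cmod (f x) \<le> C"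
    and f: "regular_in_given_by F U f"
    and \<phi>: "\<phi> \<in> test_functions_on U" "positive_fun \<phi>" "normalized \<phi>"
  shows "cmod (F \<phi>) \<le> max C 1"
proof -
  define p where "p x = Re (\<phi> x)" for x
  have \<phi>_p: "\<phi> x = complex_of_real (p x)" and p_nonneg: "0 \<le> p x" for x
    using \<phi>(2) unfolding positive_fun_def p_def by (simp_all add: complex_is_Real_iff complex_eq_iff)
  have "p \<in> real_tests U" unfolding p_def by (rule real_tests_Re[OF \<phi>(1)])
  then have p_int: "integrable lebesgue p" by (rule real_tests_integrable)
  have "complex_of_real (integral\<^sup>L lebesgue p) = 1"
    using \<phi>(3) unfolding normalized_def \<phi>_p integral_complex_of_real .
  then have p_one: "integral\<^sup>L lebesgue p = 1" using of_real_eq_1_iff by blast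
  have "F \<phi> = (LINT x|lebesgue. indicator U x *\<^sub>R (f x * \<phi> x))"
    using f \<phi>(1) unfolding regular_in_given_by_def set_lebesgue_integral_def by blast
  also have "cmod \<dots> \<le> (LINT x|lebesgue. cmod (indicator U x *\<^sub>R (f x * \<phi> x)))"
    by (rule integral_norm_bound)
  also have "\<dots> \<le> (LINT x|lebesgue. max C 1 * p x)"
  proof (rule integral_mono_AE')
    have "AE x in lebesgue. x \<in> U \<longrightarrow> cmod (f x) \<le> C"
      using C U by (simp add: AE_restrict_space_iff)
    then show "AE x in lebesgue. cmod (indicator U x *\<^sub>R (f x * \<phi> x)) \<le> max C 1 * p x"
    proof eventually_elim
      case (elim x)
      have "x \<in> U \<Longrightarrow> cmod (f x) * p x \<le> max C 1 * p x"
        using elim p_nonneg[of x] by (intro mult_right_mono) auto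
      then show ?case
        using p_nonneg[of x] by (simp add: \<phi>_p norm_mult indicator_def)
    qed
  qed (use p_int p_nonneg in auto)
  also have "\<dots> = max C 1" using p_one by simp
  finally show ?thesis .
qed

theorem lemma6p2:
  fixes F :: "(real ^ 'd::finite \<Rightarrow> complex) \<Rightarrow> complex"
    and U :: "(real ^ 'd) set"
  assumes "distribution F" and "open U"
  shows "(\<exists>f \<in> Linfty U. regular_in_given_by F U f) \<longleftrightarrow>
         (\<exists>M>0. \<forall>\<phi> \<in> test_functions_on U.
            positive_fun \<phi> \<and> normalized \<phi> \<longrightarrow> cmod (F \<phi>) \<le> M)"
proof
  assume "\<exists>f \<in> Linfty U. regular_in_given_by F U f"
  then obtain f C where "regular_in_given_by F U f" "AE x in lebesgue_on U. cmod (f x) \<le> C"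
    unfolding Linfty_def by blast
  then have "\<forall>\<phi> \<in> test_functions_on U. positive_fun \<phi> \<and> normalized \<phi> \<longrightarrow> cmod (F \<phi>) \<le> max C 1"
    using regular_bounded_imp_bound[OF \<open>open U\<close>] by blast
  then show "\<exists>M>0. \<forall>\<phi> \<in> test_functions_on U.
      positive_fun \<phi> \<and> normalized \<phi> \<longrightarrow> cmod (F \<phi>) \<le> M"
    by (intro exI[of _ "max C 1"]) auto
next
  assume "\<exists>M>0. \<forall>\<phi> \<in> test_functions_on U.
      positive_fun \<phi> \<and> normalized \<phi> \<longrightarrow> cmod (F \<phi>) \<le> M"
  then obtain M where M: "0 < M"
    "\<And>\<phi>. \<phi> \<in> test_functions_on U \<Longrightarrow> positive_fun \<phi> \<Longrightarrow> normalized \<phi> \<Longrightarrow> cmod (F \<phi>) \<le> M"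
    by blast
  have U_sets: "U \<in> sets lebesgue" using \<open>open U\<close> by simp
  let ?L = "lebesgue_on U"
  let ?F = "\<lambda>g::real ^ 'd \<Rightarrow> real. F (\<lambda>x. complex_of_real (g x))"
  interpret L: sigma_finite_measure ?L by (rule sigma_finite_measure_lebesgue_on[OF U_sets])
  have tests_int: "integrable ?L g" if "g \<in> real_tests U" for g
    using lebesgue_on_vanishing_outside(1)[OF U_sets, of g] real_tests_vanish_outside[OF that]
      real_tests_integrable[OF that] by blast
  have F_add: "?F (\<lambda>x. g x + h x) = ?F g + ?F h" if "g \<in> real_tests U" "h \<in> real_tests U" for g h
    using distribution_add[OF \<open>distribution F\<close>] that by (simp add: real_tests_def)
  have F_scale: "?F (\<lambda>x. c * g x) = of_real c * ?F g" if "g \<in> real_tests U" for c g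
    using distribution_scale[OF \<open>distribution F\<close>] that by (simp add: real_tests_def)
  have F_bound: "cmod (?F g) \<le> M * (LINT x|?L. \<bar>g x\<bar>)" if "g \<in> real_tests U" for g
    using distribution_L1_bound[OF \<open>distribution F\<close> \<open>open U\<close> M that]
      lebesgue_on_vanishing_outside(2)[OF U_sets, of "\<lambda>x. \<bar>g x\<bar>"] real_tests_vanish_outside[OF that]
    by simp
  \<comment> \<open>\<open>r\<close> will be the real and the imaginary part: both are real linear
    and do not increase the modulus, so the composition with \<open>F\<close> keeps the constant
    \<open>M\<close>.\<close>
  have component: "\<exists>f. f \<in> borel_measurable ?L \<and> (\<forall>x. \<bar>f x\<bar> \<le> M) \<and>
      (\<forall>g\<in>real_tests U. r (?F g) = (LINT x|?L. f x * g x))"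
    if r: "bounded_linear r" "\<And>z. \<bar>r z\<bar> \<le> cmod z" for r :: "complex \<Rightarrow> real"
  proof -
    interpret r: bounded_linear r by (rule r(1))
    have r_add: "r (?F (\<lambda>x. g x + h x)) = r (?F g) + r (?F h)"
      if "g \<in> real_tests U" "h \<in> real_tests U" for g h
      unfolding F_add[OF that] by (rule r.add)
    have r_scale: "r (?F (\<lambda>x. c * g x)) = c * r (?F g)" if "g \<in> real_tests U" for c g
      unfolding F_scale[OF that] by (simp add: r.scaleR flip: scaleR_conv_of_real)
    have r_bound: "\<bar>r (?F g)\<bar> \<le> M * (LINT x|?L. \<bar>g x\<bar>)" if "g \<in> real_tests U" for g
      using r(2) F_bound[OF that] by (rule order_trans)
    obtain T where T: "bounded_L1_functional ?L M T" "\<And>g. g \<in> real_tests U \<Longrightarrow> T g = r (?F g)"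
      by (rule L1_dense_extension[where T="\<lambda>g. r (?F g)", OF M(1) tests_int real_tests_add
            real_tests_scale r_add r_scale r_bound real_tests_dense_L1[OF \<open>open U\<close>]])
        (assumption+, rule that)
    obtain f where f: "f \<in> borel_measurable ?L" "\<And>x. \<bar>f x\<bar> \<le> M"
      "\<And>g. integrable ?L g \<Longrightarrow> T g = (LINT x|?L. f x * g x)"
      by (rule L.L1_dual[OF T(1) less_imp_le[OF M(1)]]) (rule that)
    have "r (?F g) = (LINT x|?L. f x * g x)" if "g \<in> real_tests U" for g
      using f(3)[OF tests_int[OF that]] T(2)[OF that] by simp
    then show ?thesis using f(1,2) by blast
  qed
  obtain u where u: "u \<in> borel_measurable ?L" "\<And>x. \<bar>u x\<bar> \<le> M"
    "\<And>g. g \<in> real_tests U \<Longrightarrow> Re (?F g) = (LINT x|?L. u x * g x)"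
    using component[OF bounded_linear_Re abs_Re_le_cmod] by blast
  obtain v where v: "v \<in> borel_measurable ?L" "\<And>x. \<bar>v x\<bar> \<le> M"
    "\<And>g. g \<in> real_tests U \<Longrightarrow> Im (?F g) = (LINT x|?L. v x * g x)"
    using component[OF bounded_linear_Im abs_Im_le_cmod] by blast
  define f where "f x = complex_of_real (u x) + \<i> * complex_of_real (v x)" for x
  have f_meas: "f \<in> borel_measurable ?L" unfolding f_def using u(1) v(1) by simp
  have f_bound: "cmod (f x) \<le> 2 * M" for x
    using cmod_le[of "f x"] u(2)[of x] v(2)[of x] by (simp add: f_def)
  have f_times_int: "integrable ?L (\<lambda>x. f x * of_real (g x))" if "integrable ?L g" for g
  proof (rule Bochner_Integration.integrable_bound)
    show "integrable ?L (\<lambda>x. 2 * M * g x)" using that by simp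
    show "AE x in ?L. norm (f x * of_real (g x)) \<le> norm (2 * M * g x)"
    proof (rule AE_I2)
      fix x
      show "norm (f x * of_real (g x)) \<le> norm (2 * M * g x)"
        using mult_right_mono[OF f_bound[of x], of "\<bar>g x\<bar>"] M(1) by (simp add: norm_mult abs_mult)
    qed
  qed (use f_meas borel_measurable_integrable[OF that] in measurable)
  have F_real: "?F g = (LINT x|?L. f x * of_real (g x))" if g: "g \<in> real_tests U" for g
  proof -
    note int = f_times_int[OF tests_int[OF g]]
    have "Re (LINT x|?L. f x * of_real (g x)) = (LINT x|?L. u x * g x)"
      "Im (LINT x|?L. f x * of_real (g x)) = (LINT x|?L. v x * g x)"
      using integral_Re[OF int] integral_Im[OF int] by (simp_all add: f_def)
    then show ?thesis using u(3)[OF g] v(3)[OF g] by (simp add: complex_eq_iff)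
  qed
  have F_eq: "F \<phi> = (LINT x:U|lebesgue. f x * \<phi> x)" if \<phi>: "\<phi> \<in> test_functions_on U" for \<phi>
  proof -
    note Re = real_tests_Re[OF \<phi>] and Im = real_tests_Im[OF \<phi>]
    \<comment> \<open>The representation is known on real test functions; complex linearity of
      \<open>F\<close> carries it over to \<open>Re (\<phi> x) + \<i> * Im (\<phi> x)\<close>, once
      the second summand is known to be a test function.\<close>
    have i_Im: "(\<lambda>x. \<i> * complex_of_real (Im (\<phi> x))) \<in> test_functions_on U"
    proof -
      obtain K where K: "smooth (\<lambda>x. complex_of_real (Im (\<phi> x)))" "compact K" "K \<subseteq> U"
        "\<And>x. x \<notin> K \<Longrightarrow> Im (\<phi> x) = 0"
        using Im by (rule real_testsE) (rule that)
      show ?thesis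
        by (rule test_functions_onI[OF smooth_mult[OF smooth_const K(1)] K(2,3)]) (simp add: K(4))
    qed
    have "F \<phi> = F (\<lambda>x. complex_of_real (Re (\<phi> x)) + \<i> * complex_of_real (Im (\<phi> x)))"
      by (simp flip: complex_eq)
    also have "\<dots> = ?F (\<lambda>x. Re (\<phi> x)) + \<i> * ?F (\<lambda>x. Im (\<phi> x))"
      using distribution_add[OF \<open>distribution F\<close> _ i_Im] distribution_scale[OF \<open>distribution F\<close>] Re Im
      by (simp add: real_tests_def)
    also have "\<dots> = (LINT x|?L. f x * of_real (Re (\<phi> x)) + \<i> * (f x * of_real (Im (\<phi> x))))"
      unfolding F_real[OF Re] F_real[OF Im]
      using f_times_int[OF tests_int[OF Re]] f_times_int[OF tests_int[OF Im]] by simp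
    also have "\<dots> = (LINT x|?L. f x * \<phi> x)"
    proof (rule Bochner_Integration.integral_cong[OF refl])
      fix x
      have "f x * of_real (Re (\<phi> x)) + \<i> * (f x * of_real (Im (\<phi> x))) =
          f x * (of_real (Re (\<phi> x)) + \<i> * of_real (Im (\<phi> x)))"
        by (simp add: algebra_simps)
      then show "f x * of_real (Re (\<phi> x)) + \<i> * (f x * of_real (Im (\<phi> x))) = f x * \<phi> x"
        by (simp flip: complex_eq)
    qed
    also have "\<dots> = (LINT x:U|lebesgue. f x * \<phi> x)"
      using U_sets by (simp add: set_lebesgue_integral_def integral_restrict_space)
    finally show ?thesis .
  qed
  have "locally_integrable_in U f"
    unfolding locally_integrable_in_def set_integrable_def
  proof (intro allI impI, elim conjE)
    fix K assume K: "compact K" "K \<subseteq> U"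
    \<comment> \<open>Integrability of \<open>f\<close> over \<open>K\<close> is the instance of
      \<open>f_times_int\<close> for the indicator of \<open>K\<close>.\<close>
    have "integrable ?L (indicator K :: _ \<Rightarrow> real)"
      using lebesgue_on_vanishing_outside(1)[OF U_sets, of "indicator K"] K
        lmeasurable_compact[OF K(1)] by (auto simp: lmeasurable_iff_integrable indicator_def)
    from f_times_int[OF this] have "integrable lebesgue (\<lambda>x. indicator U x *\<^sub>R (f x * of_real (indicator K x)))"
      using U_sets by (simp add: integrable_restrict_space)
    moreover have "indicator U x *\<^sub>R (f x * of_real (indicator K x)) = indicator K x *\<^sub>R f x" for x
      using K(2) by (auto simp: indicator_def)
    ultimately show "integrable lebesgue (\<lambda>x. indicator K x *\<^sub>R f x)" by simp
  qed
  moreover have "f \<in> Linfty U"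
    unfolding Linfty_def using f_meas f_bound by (auto intro!: exI[of _ "2 * M"])
  ultimately show "\<exists>f \<in> Linfty U. regular_in_given_by F U f"
    unfolding regular_in_given_by_def using F_eq by blast
qed

end
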